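(* Let $\Lambda$ be an approximate subgroup of a group $G$. There exists a good model $f$ of $\Lambda$ if and only if there is a sequence $(\Lambda_n)_{n\ge 0}$ of approximate subgroups of $G$ such that $\Lambda_0=\Lambda$ and, for all integers $n\ge 0$, $\Lambda_{n+1}^2\subset\Lambda_n$ and $\Lambda_n$ is commensurable to $\Lambda$.
   Context: An approximate subgroup of a group $G$ is a subset $\Lambda \subset G$ with $\Lambda=\Lambda^{-1}$, $e\in\Lambda$, and $\Lambda\Lambda\subset F\Lambda$ for some finite $F\subset G$. $\Lambda^2=\{\lambda_1\lambda_2:\lambda_i\in\Lambda\}$. Subsets $X,Y\subset G$ are commensurable if there is a finite $F\subset G$ with $X\subset FY$ and $Y\subset FX$. A good model of $\Lambda$ is a group homomorphism $f:\langle\Lambda\rangle\to H$ from the subgroup $\langle\Lambda\rangle$ generated by $\Lambda$ to a locally compact group $H$ such that $f(\Lambda)$ is relatively compact and there is a neighbourhood $U\subset H$ of the identity with $f^{-1}(U)\subset\Lambda$. *)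

theory Defs
  imports "HOL-Analysis.Analysis" "HOL-Algebra.Coset" "HOL-Algebra.Generated_Groups"
begin

definition approximate_subgroup :: "('a, 'b) monoid_scheme \<Rightarrow> 'a set \<Rightarrow> bool" where
  "approximate_subgroup G \<Lambda> \<longleftrightarrow>
     \<Lambda> \<subseteq> carrier G \<and> set_inv\<^bsub>G\<^esub> \<Lambda> = \<Lambda> \<and> \<one>\<^bsub>G\<^esub> \<in> \<Lambda> \<and>
     (\<exists>F. finite F \<and> F \<subseteq> carrier G \<and> \<Lambda> <#>\<^bsub>G\<^esub> \<Lambda> \<subseteq> F <#>\<^bsub>G\<^esub> \<Lambda>)"

definition commensurable :: "('a, 'b) monoid_scheme \<Rightarrow> 'a set \<Rightarrow> 'a set \<Rightarrow> bool" where
  "commensurable G X Y \<longleftrightarrow>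
     (\<exists>F. finite F \<and> F \<subseteq> carrier G \<and> X \<subseteq> F <#>\<^bsub>G\<^esub> Y \<and> Y \<subseteq> F <#>\<^bsub>G\<^esub> X)"

locale topological_group = group H for H :: "('h, 'm) monoid_scheme" (structure) +
  fixes T :: "'h topology"
  assumes topspace_eq_carrier: "topspace T = carrier H"
    and continuous_mult: "continuous_map (prod_topology T T) T (\<lambda>(x, y). x \<otimes> y)"
    and continuous_inv: "continuous_map T T (\<lambda>x. inv x)"

text \<open>As usual, locally compact groups are Hausdorff.\<close>

locale locally_compact_group = topological_group +
  assumes Hausdorff: "Hausdorff_space T"
    and locally_compact: "locally_compact_space T"

text \<open>Only the restriction of \<open>f\<close> to the subgroup \<open>generate G \<Lambda>\<close> is meaningful, so the preimage
  of \<open>U\<close> is taken inside that subgroup. The neighbourhood \<open>U\<close> need not be open.\<close>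

definition good_model ::
  "('a, 'b) monoid_scheme \<Rightarrow> 'a set \<Rightarrow> ('h, 'm) monoid_scheme \<Rightarrow> 'h topology \<Rightarrow> ('a \<Rightarrow> 'h) \<Rightarrow> bool"
  where
  "good_model G \<Lambda> H T f \<longleftrightarrow>
     locally_compact_group H T \<and>
     f \<in> hom (G\<lparr>carrier := generate G \<Lambda>\<rparr>) H \<and>
     compactin T (T closure_of (f ` \<Lambda>)) \<and>
     (\<exists>U V. U \<subseteq> carrier H \<and> openin T V \<and> \<one>\<^bsub>H\<^esub> \<in> V \<and> V \<subseteq> U \<and>
        {x \<in> generate G \<Lambda>. f x \<in> U} \<subseteq> \<Lambda>)"

text \<open>HOL cannot quantify existentially over the type carrying the target group \<open>H\<close>. No good model
  is lost by taking its elements in \<open>'a set set\<close>, where \<open>'a\<close> is the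
  element type of \<open>G\<close>: the target may be replaced by the closure of the
  image, and a Hausdorff space with a dense subset \<open>D\<close> has at most as many points as \<open>Pow (Pow D)\<close>.
  When a good model is a hypothesis, the target can instead be taken over an arbitrary type.\<close>

end

theory Submission
  imports Defs
begin

text \<open>
  Given a good model \<open>f\<close>, pull back a sequence of symmetric open neighbourhoods \<open>W\<^sub>n\<close> of the identity
  with \<open>W\<^sub>n\<^sub>+\<^sub>1\<^sup>2 \<subseteq> W\<^sub>n\<close>; finitely many translates of \<open>W\<^sub>n\<close> by elements of \<open>f \<Lambda>\<close> cover the relatively
  compact set \<open>f \<Lambda>\<close>, whence commensurability.

  Conversely, the finite intersections of conjugates \<open>g \<Lambda>\<^sub>n g\<^sup>-\<^sup>1\<close> with \<open>g \<in> \<langle>\<Lambda>\<rangle>\<close> form a base at the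
  identity of a group topology on \<open>\<langle>\<Lambda>\<rangle>\<close>, for which the neighbourhood \<open>\<Lambda>\<close> is precompact because
  \<open>\<Lambda> g\<close> is covered by finitely many translates of each \<open>\<Lambda>\<^sub>n\<close>. The model is the canonical map into
  the completion. Its points are the round two-sided Cauchy filters on \<open>\<langle>\<Lambda>\<rangle>\<close>, which are sets of sets.
  The sets of points containing a given \<open>A \<subseteq> \<langle>\<Lambda>\<rangle>\<close> are open, and for \<open>A = \<Lambda>\<close> the preimage
  lies in \<open>\<Lambda>\<close>.
\<close>

section \<open>From good models to chains\<close>

text \<open>Continuity of multiplication at the pair of identities gives a box
  \<open>A \<times> B\<close> mapped into \<open>V\<close>. The part of \<open>A \<inter> B\<close>
  whose inverses also lie in \<open>A \<inter> B\<close> is symmetric, and it lies in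
  \<open>V\<close> because \<open>x = x \<otimes> \<one>\<close>.\<close>

lemma (in topological_group) symmetric_open_nhd:
  assumes V: "openin T V" "\<one> \<in> V"
  obtains W where "openin T W" "\<one> \<in> W" "W \<subseteq> V" "\<And>x. x \<in> W \<Longrightarrow> inv x \<in> W"
    "\<And>x y. x \<in> W \<Longrightarrow> y \<in> W \<Longrightarrow> x \<otimes> y \<in> V"
proof -
  define P where "P = {z \<in> topspace (prod_topology T T). (case z of (x, y) \<Rightarrow> x \<otimes> y) \<in> V}"
  have "openin (prod_topology T T) P"
    unfolding P_def using continuous_mult V(1) by (rule openin_continuous_map_preimage)
  moreover have "(\<one>, \<one>) \<in> P" using V(2) by (simp add: topspace_eq_carrier P_def)
  ultimately have "\<exists>A B. openin T A \<and> openin T B \<and> \<one> \<in> A \<and> \<one> \<in> B \<and> A \<times> B \<subseteq> P"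
    by (simp only: openin_prod_topology_alt)
  then obtain A B where AB: "openin T A" "openin T B" "\<one> \<in> A" "\<one> \<in> B" "A \<times> B \<subseteq> P"
    by (elim exE conjE) (rule that)
  define W where "W = A \<inter> B \<inter> {x \<in> topspace T. inv x \<in> A \<inter> B}"
  have WG: "W \<subseteq> carrier H" by (auto simp: W_def topspace_eq_carrier)
  have mult: "x \<otimes> y \<in> V" if "x \<in> W" "y \<in> W" for x y using that AB(5) by (auto simp: W_def P_def)
  have one: "\<one> \<in> W" using AB(3,4) by (simp add: W_def topspace_eq_carrier)
  show thesis
  proof
    show "openin T W"
      unfolding W_def using AB(1,2) openin_continuous_map_preimage[OF continuous_inv] by blast
    show "\<one> \<in> W" by fact
    show "W \<subseteq> V"
    proof
      fix x assume x: "x \<in> W"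
      then have "x \<otimes> \<one> \<in> V" using one by (rule mult)
      moreover have "x \<in> carrier H" using x WG by blast
      ultimately show "x \<in> V" by simp
    qed
    show "inv x \<in> W" if "x \<in> W" for x
      using that WG by (auto simp: W_def topspace_eq_carrier)
    show "x \<otimes> y \<in> V" if "x \<in> W" "y \<in> W" for x y using that by (rule mult)
  qed
qed

lemma (in topological_group) openin_translate:
  assumes "openin T W" "k \<in> carrier H"
  shows "openin T {h \<in> carrier H. k \<otimes> h \<in> W}"
proof -
  have "continuous_map T (prod_topology T T) (\<lambda>h. (k, h))"
    using assms(2) by (simp add: continuous_map_pairedI topspace_eq_carrier)
  then have "continuous_map T T ((\<lambda>(x, y). x \<otimes> y) \<circ> (\<lambda>h. (k, h)))"
    using continuous_mult by (rule continuous_map_compose)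
  from openin_continuous_map_preimage[OF this assms(1)] show ?thesis
    by (simp add: topspace_eq_carrier)
qed

text \<open>Translates of \<open>W\<close> centred in \<open>A\<close> already cover the closure:
  the neighbourhood \<open>k W\<close> of a closure point \<open>k\<close> contains some
  \<open>a \<in> A\<close>, and symmetry of \<open>W\<close> turns this into
  \<open>k \<in> a W\<close>. Centres in \<open>A\<close> can later be lifted through a
  homomorphism, centres in the closure could not.\<close>

lemma (in topological_group) compactin_closure_translates:
  assumes K: "compactin T (T closure_of A)" and A: "A \<subseteq> carrier H"
    and W: "openin T W" "\<one> \<in> W" "\<And>x. x \<in> W \<Longrightarrow> inv x \<in> W"
  obtains F where "finite F" "F \<subseteq> A" "\<And>a. a \<in> A \<Longrightarrow> \<exists>b\<in>F. inv b \<otimes> a \<in> W"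
proof -
  let ?O = "\<lambda>b. {h \<in> carrier H. inv b \<otimes> h \<in> W}"
  have "T closure_of A \<subseteq> \<Union>(?O ` A)"
  proof
    fix k assume k: "k \<in> T closure_of A"
    have kG: "k \<in> carrier H" using closure_of_subset_topspace[of T A] k topspace_eq_carrier by blast
    have meet: "\<exists>a. a \<in> A \<and> a \<in> U" if "openin T U" "k \<in> U" for U
      using k that by (simp add: in_closure_of)
    have "\<exists>a. a \<in> A \<and> a \<in> {h \<in> carrier H. inv k \<otimes> h \<in> W}"
      using W kG by (intro meet) (simp_all add: openin_translate)
    then obtain a where a: "a \<in> A" "inv k \<otimes> a \<in> W" by blast
    have "inv (inv k \<otimes> a) = inv a \<otimes> k" using a(1) A kG by (simp add: inv_mult_group subset_iff)
    then have "k \<in> ?O a" using W(3)[OF a(2)] kG by simp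
    then show "k \<in> \<Union>(?O ` A)" using a(1) by blast
  qed
  moreover have "openin T (?O b)" if "b \<in> A" for b
    using W(1) A that by (simp add: openin_translate subset_iff)
  ultimately have "\<exists>\<F>. finite \<F> \<and> \<F> \<subseteq> ?O ` A \<and> T closure_of A \<subseteq> \<Union>\<F>"
    by (intro compactinD[OF K]) auto
  then obtain \<F> where \<F>: "finite \<F>" "\<F> \<subseteq> ?O ` A" "T closure_of A \<subseteq> \<Union>\<F>"
    by (elim exE conjE) (rule that)
  obtain F where F: "F \<subseteq> A" "finite F" "\<F> = ?O ` F"
    using finite_subset_image[OF \<F>(1,2)] by (elim exE conjE) (rule that)
  have "A \<subseteq> T closure_of A" using A by (simp add: closure_of_subset topspace_eq_carrier)
  then have "\<exists>b\<in>F. inv b \<otimes> a \<in> W" if "a \<in> A" for a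
    using that F(3) \<F>(3) by auto
  then show thesis using F by (intro that[of F])
qed

section \<open>Large symmetric subsets of an approximate subgroup\<close>

lemma approximate_subgroupD:
  assumes "approximate_subgroup G \<Lambda>"
  shows "\<Lambda> \<subseteq> carrier G" "\<one>\<^bsub>G\<^esub> \<in> \<Lambda>" "\<And>x. x \<in> \<Lambda> \<Longrightarrow> inv\<^bsub>G\<^esub> x \<in> \<Lambda>"
    "\<exists>F. finite F \<and> F \<subseteq> carrier G \<and> \<Lambda> <#>\<^bsub>G\<^esub> \<Lambda> \<subseteq> F <#>\<^bsub>G\<^esub> \<Lambda>"
proof -
  have "set_inv\<^bsub>G\<^esub> \<Lambda> = \<Lambda>" using assms by (simp add: approximate_subgroup_def)
  then show "\<And>x. x \<in> \<Lambda> \<Longrightarrow> inv\<^bsub>G\<^esub> x \<in> \<Lambda>" unfolding SET_INV_def by blast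
qed (use assms in \<open>simp_all add: approximate_subgroup_def\<close>)

lemma finite_set_mult: "finite A \<Longrightarrow> finite B \<Longrightarrow> finite (A <#>\<^bsub>G\<^esub> B)"
  by (simp add: set_mult_def)

text \<open>If \<open>E\<close> covers the square of \<Lambda> by translates of \<Lambda>, then
  \<open>E <#> F\<close> does the same for \<open>M\<close>, since each translate of \<Lambda>
  splits into translates of \<open>M\<close> by \<open>F\<close>.\<close>

lemma (in group) approximate_subgroup_of_large_subset:
  assumes L: "approximate_subgroup G \<Lambda>" and M: "M \<subseteq> \<Lambda>" "\<one> \<in> M" "\<And>x. x \<in> M \<Longrightarrow> inv x \<in> M"
    and F: "finite F" "F \<subseteq> carrier G" "\<Lambda> \<subseteq> F <#> M"
  shows "approximate_subgroup G M" "commensurable G M \<Lambda>"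
proof -
  note D = approximate_subgroupD[OF L]
  have MG: "M \<subseteq> carrier G" using M(1) D(1) by blast
  obtain E where E: "finite E" "E \<subseteq> carrier G" "\<Lambda> <#> \<Lambda> \<subseteq> E <#> \<Lambda>" using D(4) by blast
  have "M <#> M \<subseteq> E <#> \<Lambda>" using mono_set_mult[OF M(1) M(1)] E(3) by blast
  also have "\<dots> \<subseteq> E <#> (F <#> M)" using F(3) by (simp add: mono_set_mult)
  also have "\<dots> = (E <#> F) <#> M" using E(2) F(2) MG by (simp add: set_mult_assoc)
  finally have "M <#> M \<subseteq> (E <#> F) <#> M" .
  moreover have "set_inv M = M"
  proof
    show "set_inv M \<subseteq> M" using M(3) by (auto simp: SET_INV_def)
    show "M \<subseteq> set_inv M"
    proof
      fix x assume x: "x \<in> M"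
      then have "x = inv (inv x)" using MG by auto
      then show "x \<in> set_inv M" using M(3)[OF x] unfolding SET_INV_def by blast
    qed
  qed
  moreover have "finite (E <#> F)" "E <#> F \<subseteq> carrier G"
    using E(1,2) F(1,2) by (simp_all add: finite_set_mult set_mult_closed)
  ultimately show "approximate_subgroup G M"
    unfolding approximate_subgroup_def using MG M(2) by blast
  \<comment> \<open>A single finite set has to serve both inclusions; adding \<open>\<one>\<close>
    to \<open>F\<close> takes care of \<open>M \<subseteq> \<Lambda>\<close>.\<close>
  have "M \<subseteq> insert \<one> F <#> \<Lambda>"
  proof
    fix x assume "x \<in> M"
    then have "x \<in> \<Lambda>" "x = \<one> \<otimes> x" using M(1) MG by auto
    then show "x \<in> insert \<one> F <#> \<Lambda>" unfolding set_mult_def by blast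
  qed
  moreover have "\<Lambda> \<subseteq> insert \<one> F <#> M" using F(3) by (auto simp: set_mult_def)
  ultimately show "commensurable G M \<Lambda>"
    unfolding commensurable_def using F(1,2) by (intro exI[of _ "insert \<one> F"]) auto
qed

section \<open>Preimages of shrinking neighbourhoods under a good model\<close>

text \<open>The target group has an arbitrary type here, so that both forms of the hypothesis in the
  final theorem are instances.\<close>

lemma good_model_imp_chain:
  fixes G :: "('a, 'b) monoid_scheme" (structure)
  assumes "group G" and L: "approximate_subgroup G \<Lambda>" and good: "good_model G \<Lambda> H T f"
  shows "\<exists>L :: nat \<Rightarrow> 'a set.
     (\<forall>n. approximate_subgroup G (L n)) \<and> L 0 = \<Lambda> \<and>
     (\<forall>n. L (Suc n) <#>\<^bsub>G\<^esub> L (Suc n) \<subseteq> L n \<and> commensurable G (L n) \<Lambda>)"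
proof -
  interpret group G by fact
  interpret H: locally_compact_group H T using good by (simp add: good_model_def)
  note D = approximate_subgroupD[OF L]
  define \<Gamma> where "\<Gamma> = generate G \<Lambda>"
  have sub: "subgroup \<Gamma> G" unfolding \<Gamma>_def using D(1) by (rule generate_is_subgroup)
  have \<Lambda>\<Gamma>: "\<Lambda> \<subseteq> \<Gamma>" unfolding \<Gamma>_def by (auto intro: generate.incl)
  have f: "f \<in> hom (G\<lparr>carrier := \<Gamma>\<rparr>) H" using good by (simp add: good_model_def \<Gamma>_def)
  interpret f: group_hom "G\<lparr>carrier := \<Gamma>\<rparr>" H f
    using subgroup_imp_group[OF sub] f by (simp add: group_hom_def group_hom_axioms_def)
  have f_mult: "f (x \<otimes> y) = f x \<otimes>\<^bsub>H\<^esub> f y" if "x \<in> \<Gamma>" "y \<in> \<Gamma>" for x y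
    using f.hom_mult that by simp
  have f_inv: "f (inv x) = inv\<^bsub>H\<^esub> f x" if "x \<in> \<Gamma>" for x
    using f.hom_inv[of x] m_inv_consistent[OF sub that] that by simp
  have f_one: "f \<one> = \<one>\<^bsub>H\<^esub>" using f.hom_one by simp
  have f_closed: "f x \<in> carrier H" if "x \<in> \<Gamma>" for x using f.hom_closed that by simp
  have cpt: "compactin T (T closure_of (f ` \<Lambda>))" using good by (simp add: good_model_def)
  have "\<exists>U V. U \<subseteq> carrier H \<and> openin T V \<and> \<one>\<^bsub>H\<^esub> \<in> V \<and> V \<subseteq> U \<and> {x \<in> \<Gamma>. f x \<in> U} \<subseteq> \<Lambda>"
    using good by (simp add: good_model_def \<Gamma>_def)
  then obtain V where V: "openin T V" "\<one>\<^bsub>H\<^esub> \<in> V" "{x \<in> \<Gamma>. f x \<in> V} \<subseteq> \<Lambda>"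
  proof (elim exE conjE)
    fix U V assume "openin T V" "\<one>\<^bsub>H\<^esub> \<in> V" "V \<subseteq> U" "{x \<in> \<Gamma>. f x \<in> U} \<subseteq> \<Lambda>"
    then show thesis by (intro that[of V]) auto
  qed
  \<comment> \<open>All neighbourhoods stay inside \<open>V\<close>, so that every preimage is a
    subset of \<Lambda> and can be compared with it.\<close>
  let ?P = "\<lambda>W. openin T W \<and> \<one>\<^bsub>H\<^esub> \<in> W \<and> W \<subseteq> V \<and> (\<forall>x\<in>W. inv\<^bsub>H\<^esub> x \<in> W)"
  have "\<exists>W :: nat \<Rightarrow> _ set. \<forall>n. ?P (W n) \<and> (\<forall>x\<in>W (Suc n). \<forall>y\<in>W (Suc n). x \<otimes>\<^bsub>H\<^esub> y \<in> W n)"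
  proof (rule dependent_nat_choice)
    show "\<exists>W. ?P W" using H.symmetric_open_nhd[OF V(1,2)] by metis
    show "\<exists>W'. ?P W' \<and> (\<forall>x\<in>W'. \<forall>y\<in>W'. x \<otimes>\<^bsub>H\<^esub> y \<in> W)" if "?P W" for W and n :: nat
    proof -
      obtain W' where "openin T W'" "\<one>\<^bsub>H\<^esub> \<in> W'" "W' \<subseteq> W" "\<And>x. x \<in> W' \<Longrightarrow> inv\<^bsub>H\<^esub> x \<in> W'"
        "\<And>x y. x \<in> W' \<Longrightarrow> y \<in> W' \<Longrightarrow> x \<otimes>\<^bsub>H\<^esub> y \<in> W"
        using H.symmetric_open_nhd[of W] \<open>?P W\<close> by metis
      then show ?thesis using \<open>?P W\<close> by (intro exI[of _ W']) auto
    qed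
  qed
  then obtain W :: "nat \<Rightarrow> _ set"
    where W0: "\<And>n. ?P (W n) \<and> (\<forall>x\<in>W (Suc n). \<forall>y\<in>W (Suc n). x \<otimes>\<^bsub>H\<^esub> y \<in> W n)"
    by (elim exE) (rule that, rule spec)
  have W: "\<And>n. openin T (W n)" "\<And>n. \<one>\<^bsub>H\<^esub> \<in> W n" "\<And>n. W n \<subseteq> V"
      "\<And>n x. x \<in> W n \<Longrightarrow> inv\<^bsub>H\<^esub> x \<in> W n"
    and W_mult: "\<And>n x y. x \<in> W (Suc n) \<Longrightarrow> y \<in> W (Suc n) \<Longrightarrow> x \<otimes>\<^bsub>H\<^esub> y \<in> W n"
    using W0 by simp_all
  define M where "M n = {x \<in> \<Gamma>. f x \<in> W n}" for n
  have M_sub: "M n \<subseteq> \<Lambda>" for n using V(3) W(3) by (auto simp: M_def)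
  have M: "approximate_subgroup G (M n) \<and> commensurable G (M n) \<Lambda>" for n
  proof -
    have "f ` \<Lambda> \<subseteq> carrier H" using \<Lambda>\<Gamma> f_closed by auto
    then obtain F where F: "finite F" "F \<subseteq> f ` \<Lambda>" "\<And>a. a \<in> f ` \<Lambda> \<Longrightarrow> \<exists>b\<in>F. inv\<^bsub>H\<^esub> b \<otimes>\<^bsub>H\<^esub> a \<in> W n"
      using H.compactin_closure_translates[OF cpt _ W(1,2,4)] by metis
    \<comment> \<open>The centres are values of \<open>f\<close> on \<Lambda>, hence come from a
      finite \<open>E\<close>; if \<open>f x\<close> lies in the translate of \<open>W n\<close> by
      \<open>f y\<close>, then \<open>x\<close> lies in the translate of \<open>M n\<close> by
      \<open>y\<close>.\<close>
    obtain E where E: "finite E" "E \<subseteq> \<Lambda>" "F = f ` E"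
      using finite_subset_image[OF F(1,2)] by blast
    have cov: "\<Lambda> \<subseteq> E <#> M n"
    proof
      fix x assume x: "x \<in> \<Lambda>"
      then obtain y where y: "y \<in> E" "inv\<^bsub>H\<^esub> f y \<otimes>\<^bsub>H\<^esub> f x \<in> W n" using F(3) E(3) by blast
      have G: "x \<in> \<Gamma>" "y \<in> \<Gamma>" using x y(1) E(2) \<Lambda>\<Gamma> by auto
      have "inv y \<otimes> x \<in> M n"
        using G y(2) subgroup.m_inv_closed[OF sub] subgroup.m_closed[OF sub]
        by (simp add: M_def f_mult f_inv)
      moreover have "x = y \<otimes> (inv y \<otimes> x)"
        using G subgroup.mem_carrier[OF sub] by (simp flip: m_assoc)
      ultimately show "x \<in> E <#> M n" using y(1) unfolding set_mult_def by blast
    qed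
    have "\<one> \<in> M n" using W(2) f_one subgroup.one_closed[OF sub] by (simp add: M_def)
    moreover have "inv x \<in> M n" if "x \<in> M n" for x
      using that W(4) subgroup.m_inv_closed[OF sub] by (auto simp: M_def f_inv)
    ultimately show ?thesis
      using approximate_subgroup_of_large_subset[OF L M_sub _ _ E(1) _ cov] E(2) D(1) by blast
  qed
  have M_mult: "x \<otimes> y \<in> M n" if "x \<in> M (Suc n)" "y \<in> M (Suc n)" for x y n
    using that W_mult subgroup.m_closed[OF sub] by (auto simp: M_def f_mult)
  have "\<Lambda> \<subseteq> {\<one>} <#> \<Lambda>" using D(1) by (auto simp: set_mult_def subset_iff intro!: bexI[of _ _ \<Lambda>])
  then have "commensurable G \<Lambda> \<Lambda>"
    using approximate_subgroup_of_large_subset(2)[OF L order_refl D(2,3), of "{\<one>}"] by simp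
  \<comment> \<open>\<open>M 0\<close> may be smaller than \<Lambda>, which takes its place at index
    \<open>0\<close>; the first product condition survives because
    \<open>M 0 \<subseteq> \<Lambda>\<close>.\<close>
  moreover have "x \<otimes> y \<in> \<Lambda>" if "x \<in> M (Suc 0)" "y \<in> M (Suc 0)" for x y
    using M_mult[OF that] M_sub by blast
  ultimately show ?thesis
    using M L M_mult
    by (intro exI[of _ "\<lambda>n. if n = 0 then \<Lambda> else M n"]) (auto simp: set_mult_def)
qed

section \<open>Completion of a group with a neighbourhood filter\<close>

text \<open>Zorn's lemma gives a maximal family \<open>M\<close> containing \<open>I\<close> of
  which no finite part covers \<open>A\<close>. The sets containing \<open>A - \<Union>K\<close> for
  some finite \<open>K \<subseteq> M\<close> form the ultrafilter. The last conclusion is its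
  maximality in the form needed for compactness: each finite cover of \<open>A\<close> has a member
  in \<open>u\<close>.\<close>

lemma ultrafilter_avoiding:
  assumes "\<nexists>K. finite K \<and> K \<subseteq> I \<and> A \<subseteq> \<Union>K"
  shows "\<exists>u. A \<in> u \<and> {} \<notin> u \<and> (\<forall>B\<in>u. \<forall>C\<in>u. B \<inter> C \<in> u) \<and> (\<forall>B\<in>u. \<forall>C. B \<subseteq> C \<longrightarrow> C \<in> u) \<and>
    (\<forall>B\<in>I. B \<notin> u) \<and> (\<forall>\<C>. finite \<C> \<and> A \<subseteq> \<Union>\<C> \<longrightarrow> (\<exists>C\<in>\<C>. C \<in> u))"
proof -
  define bad where "bad = {J. I \<subseteq> J \<and> (\<forall>K. finite K \<longrightarrow> K \<subseteq> J \<longrightarrow> \<not> A \<subseteq> \<Union>K)}"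
  have "\<exists>M\<in>bad. \<forall>J\<in>bad. M \<subseteq> J \<longrightarrow> J = M"
  proof (rule subset_Zorn_nonempty)
    show "bad \<noteq> {}" using assms by (auto simp: bad_def)
  next
    fix \<C> assume ne: "\<C> \<noteq> {}" and ch: "subset.chain bad \<C>"
    have "\<not> A \<subseteq> \<Union>K" if K: "finite K" "K \<subseteq> \<Union>\<C>" for K
    proof -
      obtain J where "J \<in> \<C>" "K \<subseteq> J"
        using finite_subset_Union_chain[OF K ne ch] by blast
      then show ?thesis
        using ch K(1) by (auto simp: subset.chain_def bad_def)
    qed
    moreover obtain J where "J \<in> \<C>" using ne by blast
    then have "I \<subseteq> \<Union>\<C>" using ch by (auto simp: subset.chain_def bad_def)
    ultimately show "\<Union>\<C> \<in> bad" by (simp add: bad_def)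
  qed
  then obtain M where M: "M \<in> bad" and max: "\<And>J. J \<in> bad \<Longrightarrow> M \<subseteq> J \<Longrightarrow> J = M" by blast
  have I: "I \<subseteq> M" and notcov: "\<And>K. finite K \<Longrightarrow> K \<subseteq> M \<Longrightarrow> \<not> A \<subseteq> \<Union>K"
    using M by (auto simp: bad_def)
  define u where "u = {S. \<exists>K. finite K \<and> K \<subseteq> M \<and> A - \<Union>K \<subseteq> S}"
  have uI: "S \<in> u" if "finite K" "K \<subseteq> M" "A - \<Union>K \<subseteq> S" for K S
    unfolding u_def using that by blast
  show ?thesis
  proof (intro exI[of _ u] conjI ballI allI impI)
    show "A \<in> u" using uI[of "{}"] by simp
    show "{} \<notin> u" using notcov by (auto simp: u_def)
    show "B \<inter> C \<in> u" if "B \<in> u" "C \<in> u" for B C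
    proof -
      obtain K where "finite K" "K \<subseteq> M" "A - \<Union>K \<subseteq> B"
        using \<open>B \<in> u\<close> unfolding u_def by blast
      moreover obtain L where "finite L" "L \<subseteq> M" "A - \<Union>L \<subseteq> C"
        using \<open>C \<in> u\<close> unfolding u_def by blast
      ultimately show ?thesis by (intro uI[of "K \<union> L"]) auto
    qed
    show "C \<in> u" if "B \<in> u" "B \<subseteq> C" for B C
      using that unfolding u_def by (blast intro: order_trans)
    show "B \<notin> u" if "B \<in> I" for B
    proof
      assume "B \<in> u"
      then obtain K where "finite K" "K \<subseteq> M" "A - \<Union>K \<subseteq> B" by (auto simp: u_def)
      then show False using notcov[of "insert B K"] that I by auto
    qed
    show "\<exists>C\<in>\<C>. C \<in> u" if \<C>: "finite \<C> \<and> A \<subseteq> \<Union>\<C>" for \<C>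
    proof -
      \<comment> \<open>Some member \<open>C\<close> of the cover is missing from \<open>M\<close>.
        By maximality, \<open>C\<close> together with finitely many members of \<open>M\<close>
        covers \<open>A\<close>, so \<open>C\<close> contains what these members leave of
        \<open>A\<close>.\<close>
      obtain C where C: "C \<in> \<C>" "C \<notin> M" using notcov[of \<C>] \<C> by blast
      then have "insert C M \<notin> bad" using max[of "insert C M"] by auto
      then obtain K where K: "finite K" "K \<subseteq> insert C M" "A \<subseteq> \<Union>K"
        using I by (auto simp: bad_def)
      then have "C \<in> u" by (intro uI[of "K - {C}"]) auto
      then show ?thesis using C(1) by blast
    qed
  qed
qed

text \<open>Total boundedness of \<open>A\<close> with respect to an entourage \<open>R\<close>. An
  arbitrary relation is allowed, so that left and right quotients can be controlled separately and
  then combined.\<close>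

definition finite_cover_by :: "('a \<Rightarrow> 'a \<Rightarrow> bool) \<Rightarrow> 'a set \<Rightarrow> bool" where
  "finite_cover_by R A \<longleftrightarrow>
     (\<exists>\<C>. finite \<C> \<and> A \<subseteq> \<Union>\<C> \<and> (\<forall>C\<in>\<C>. \<forall>a\<in>C. \<forall>b\<in>C. R a b))"

text \<open>Covers pull back along \<open>h\<close>. The maps used are translations, inversion,
  which exchanges left and right quotients, and the identity, which only weakens the
  relation.\<close>

lemma finite_cover_by_vimage:
  assumes "finite_cover_by R A" "h ` B \<subseteq> A" "\<And>a b. a \<in> B \<Longrightarrow> b \<in> B \<Longrightarrow> R (h a) (h b) \<Longrightarrow> S a b"
  shows "finite_cover_by S B"
proof -
  obtain \<C> where \<C>: "finite \<C>" "A \<subseteq> \<Union>\<C>" "\<forall>C\<in>\<C>. \<forall>a\<in>C. \<forall>b\<in>C. R a b"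
    using assms(1) by (auto simp: finite_cover_by_def)
  let ?\<D> = "(\<lambda>C. {b \<in> B. h b \<in> C}) ` \<C>"
  have "finite ?\<D>" using \<C>(1) by simp
  moreover have "B \<subseteq> \<Union>?\<D>" using \<C>(2) assms(2) by blast
  moreover have "\<forall>D\<in>?\<D>. \<forall>a\<in>D. \<forall>b\<in>D. S a b" using \<C>(3) assms(3) by simp
  ultimately show ?thesis unfolding finite_cover_by_def by blast
qed

text \<open>The pairwise intersections of members of two covers are small for both
  relations.\<close>

lemma finite_cover_by_conj:
  assumes "finite_cover_by R A" "finite_cover_by S A"
  shows "finite_cover_by (\<lambda>a b. R a b \<and> S a b) A"
proof -
  obtain \<C> where C: "finite \<C>" "A \<subseteq> \<Union>\<C>" "\<forall>C\<in>\<C>. \<forall>a\<in>C. \<forall>b\<in>C. R a b"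
    using assms(1) by (auto simp: finite_cover_by_def)
  obtain \<D> where D: "finite \<D>" "A \<subseteq> \<Union>\<D>" "\<forall>C\<in>\<D>. \<forall>a\<in>C. \<forall>b\<in>C. S a b"
    using assms(2) by (auto simp: finite_cover_by_def)
  have "finite ((\<lambda>(C, D). C \<inter> D) ` (\<C> \<times> \<D>))" using C D by auto
  moreover have "A \<subseteq> \<Union>((\<lambda>(C, D). C \<inter> D) ` (\<C> \<times> \<D>))" using C(2) D(2) by fastforce
  ultimately show ?thesis
    unfolding finite_cover_by_def using C(3) D(3)
    by (intro exI[of _ "(\<lambda>(C, D). C \<inter> D) ` (\<C> \<times> \<D>)"]) auto
qed

lemma finite_cover_by_ball:
  assumes "finite F" "\<And>g. g \<in> F \<Longrightarrow> finite_cover_by (R g) A"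
  shows "finite_cover_by (\<lambda>a b. \<forall>g\<in>F. R g a b) A"
  using assms
proof (induction F)
  case empty
  then show ?case unfolding finite_cover_by_def by (auto intro: exI[of _ "{A}"])
next
  case (insert g F)
  then show ?case using finite_cover_by_conj[of "R g" A "\<lambda>a b. \<forall>g\<in>F. R g a b"] by simp
qed

lemma (in group) inv_cancel:
  assumes "x \<in> carrier G" "y \<in> carrier G"
  shows "inv x \<otimes> (x \<otimes> y) = y" "x \<otimes> (inv x \<otimes> y) = y"
  using assms by (simp_all flip: m_assoc)

section \<open>Neighbourhood filters of the identity\<close>

text \<open>\<open>N\<close> is the filter of all neighbourhoods of the identity, open or not, in a
  group topology: \<open>nhds_div\<close> is continuity of division at the identity,
  \<open>nhds_conj\<close> continuity of conjugations there. The topology may fail to be Hausdorff;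
  inseparable elements become equal in the completion.\<close>

locale group_nhds = group G for G :: "('a, 'b) monoid_scheme" (structure) +
  fixes N :: "'a set set"
  assumes nhds_subset: "V \<in> N \<Longrightarrow> V \<subseteq> carrier G"
    and one_mem_nhds: "V \<in> N \<Longrightarrow> \<one> \<in> V"
    and carrier_nhds: "carrier G \<in> N"
    and nhds_Int: "V \<in> N \<Longrightarrow> W \<in> N \<Longrightarrow> V \<inter> W \<in> N"
    and nhds_mono: "V \<in> N \<Longrightarrow> V \<subseteq> W \<Longrightarrow> W \<subseteq> carrier G \<Longrightarrow> W \<in> N"
    and nhds_div: "V \<in> N \<Longrightarrow> \<exists>W\<in>N. \<forall>x\<in>W. \<forall>y\<in>W. inv x \<otimes> y \<in> V"
    and nhds_conj: "V \<in> N \<Longrightarrow> x \<in> carrier G \<Longrightarrow> \<exists>W\<in>N. \<forall>y\<in>W. x \<otimes> y \<otimes> inv x \<in> V"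
begin

lemma nhds_carrier: "V \<in> N \<Longrightarrow> x \<in> V \<Longrightarrow> x \<in> carrier G"
  using nhds_subset by blast

lemma nhds_INT:
  assumes "finite K" "\<And>i. i \<in> K \<Longrightarrow> V i \<in> N"
  shows "carrier G \<inter> (\<Inter>i\<in>K. V i) \<in> N"
  using assms
proof (induction K)
  case empty
  then show ?case by (simp add: carrier_nhds)
next
  case (insert i K)
  then have "V i \<inter> (carrier G \<inter> (\<Inter>i\<in>K. V i)) \<in> N" using nhds_Int by simp
  then show ?case by (simp add: Int_left_commute)
qed

lemma nhds_inv:
  assumes "V \<in> N" shows "\<exists>W\<in>N. \<forall>x\<in>W. inv x \<in> V"
proof -
  obtain W where W: "W \<in> N" "\<forall>x\<in>W. \<forall>y\<in>W. inv x \<otimes> y \<in> V" using nhds_div[OF assms] by blast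
  have "inv x \<in> V" if "x \<in> W" for x
    using W that one_mem_nhds[OF W(1)] nhds_carrier[OF W(1) that] by force
  then show ?thesis using W(1) by blast
qed

lemma nhds_mult:
  assumes "V \<in> N" shows "\<exists>W\<in>N. \<forall>x\<in>W. \<forall>y\<in>W. x \<otimes> y \<in> V"
proof -
  obtain W where W: "W \<in> N" "\<forall>x\<in>W. \<forall>y\<in>W. inv x \<otimes> y \<in> V" using nhds_div[OF assms] by blast
  obtain W' where W': "W' \<in> N" "\<forall>x\<in>W'. inv x \<in> W" using nhds_inv[OF W(1)] by blast
  have "x \<otimes> y \<in> V" if "x \<in> W' \<inter> W" "y \<in> W' \<inter> W" for x y
  proof -
    have "inv (inv x) \<otimes> y \<in> V" using W W' that by blast
    then show ?thesis using nhds_carrier[OF W(1)] that by simp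
  qed
  then show ?thesis using nhds_Int[OF W'(1) W(1)] by blast
qed

lemma nhds_mult3:
  assumes "V \<in> N" shows "\<exists>W\<in>N. \<forall>x\<in>W. \<forall>y\<in>W. \<forall>z\<in>W. x \<otimes> y \<otimes> z \<in> V"
proof -
  obtain W where W: "W \<in> N" "\<forall>x\<in>W. \<forall>y\<in>W. x \<otimes> y \<in> V" using nhds_mult[OF assms] by blast
  obtain W' where W': "W' \<in> N" "\<forall>x\<in>W'. \<forall>y\<in>W'. x \<otimes> y \<in> W" using nhds_mult[OF W(1)] by blast
  show ?thesis using W W' nhds_Int[OF W'(1) W(1)] by (intro bexI[of _ "W' \<inter> W"]) auto
qed

section \<open>Round Cauchy filters for the two-sided uniformity\<close>

text \<open>Both quotients are controlled, which gives the two-sided uniformity. Inversion preserves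
  its Cauchy filters, whereas it need not preserve those of the left uniformity.\<close>

definition small :: "'a set \<Rightarrow> 'a \<Rightarrow> 'a \<Rightarrow> bool" where
  "small V a b \<longleftrightarrow> inv a \<otimes> b \<in> V \<and> a \<otimes> inv b \<in> V"

text \<open>The last two clauses say that the filter is Cauchy and round. Roundness selects one
  representative from each class of equivalent Cauchy filters, so the completion is obtained without
  a quotient and its elements are sets of sets.\<close>

definition points :: "'a set set set" where
  "points = {p. p \<subseteq> Pow (carrier G) \<and> carrier G \<in> p \<and> {} \<notin> p \<and>
     (\<forall>A\<in>p. \<forall>B\<in>p. A \<inter> B \<in> p) \<and> (\<forall>A\<in>p. \<forall>B. A \<subseteq> B \<longrightarrow> B \<subseteq> carrier G \<longrightarrow> B \<in> p) \<and>
     (\<forall>V\<in>N. \<exists>C\<in>p. \<forall>a\<in>C. \<forall>b\<in>C. small V a b) \<and>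
     (\<forall>A\<in>p. \<exists>B\<in>p. \<exists>V\<in>N. B <#> V \<subseteq> A)}"

lemma pointsI:
  assumes "\<And>A. A \<in> p \<Longrightarrow> A \<subseteq> carrier G" "carrier G \<in> p" "{} \<notin> p"
    "\<And>A B. A \<in> p \<Longrightarrow> B \<in> p \<Longrightarrow> A \<inter> B \<in> p"
    "\<And>A B. A \<in> p \<Longrightarrow> A \<subseteq> B \<Longrightarrow> B \<subseteq> carrier G \<Longrightarrow> B \<in> p"
    "\<And>V. V \<in> N \<Longrightarrow> \<exists>C\<in>p. \<forall>a\<in>C. \<forall>b\<in>C. small V a b"
    "\<And>A. A \<in> p \<Longrightarrow> \<exists>B\<in>p. \<exists>V\<in>N. B <#> V \<subseteq> A"
  shows "p \<in> points"
  unfolding points_def mem_Collect_eq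
proof (intro conjI)
  show "p \<subseteq> Pow (carrier G)" using assms(1) by blast
  show "\<forall>A\<in>p. \<forall>B\<in>p. A \<inter> B \<in> p" using assms(4) by simp
  show "\<forall>A\<in>p. \<forall>B. A \<subseteq> B \<longrightarrow> B \<subseteq> carrier G \<longrightarrow> B \<in> p" using assms(5) by simp
  show "\<forall>V\<in>N. \<exists>C\<in>p. \<forall>a\<in>C. \<forall>b\<in>C. small V a b" using assms(6) by simp
  show "\<forall>A\<in>p. \<exists>B\<in>p. \<exists>V\<in>N. B <#> V \<subseteq> A" using assms(7) by simp
qed fact+

lemma pointsD:
  assumes "p \<in> points"
  shows "\<And>A. A \<in> p \<Longrightarrow> A \<subseteq> carrier G" "carrier G \<in> p" "{} \<notin> p"
    "\<And>A B. A \<in> p \<Longrightarrow> B \<in> p \<Longrightarrow> A \<inter> B \<in> p"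
    "\<And>A B. A \<in> p \<Longrightarrow> A \<subseteq> B \<Longrightarrow> B \<subseteq> carrier G \<Longrightarrow> B \<in> p"
    "\<And>V. V \<in> N \<Longrightarrow> \<exists>C\<in>p. \<forall>a\<in>C. \<forall>b\<in>C. small V a b"
    "\<And>A. A \<in> p \<Longrightarrow> \<exists>B\<in>p. \<exists>V\<in>N. B <#> V \<subseteq> A"
proof -
  note * = assms[unfolded points_def mem_Collect_eq]
  note tail = *[THEN conjunct2, THEN conjunct2, THEN conjunct2]
  show "\<And>A. A \<in> p \<Longrightarrow> A \<subseteq> carrier G" using *[THEN conjunct1] by blast
  show "carrier G \<in> p" by (rule *[THEN conjunct2, THEN conjunct1])
  show "{} \<notin> p" by (rule *[THEN conjunct2, THEN conjunct2, THEN conjunct1])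
  show "\<And>A B. A \<in> p \<Longrightarrow> B \<in> p \<Longrightarrow> A \<inter> B \<in> p" using tail[THEN conjunct1] by simp
  show "\<And>A B. A \<in> p \<Longrightarrow> A \<subseteq> B \<Longrightarrow> B \<subseteq> carrier G \<Longrightarrow> B \<in> p"
    using tail[THEN conjunct2, THEN conjunct1] by simp
  show "\<And>V. V \<in> N \<Longrightarrow> \<exists>C\<in>p. \<forall>a\<in>C. \<forall>b\<in>C. small V a b"
    using tail[THEN conjunct2, THEN conjunct2, THEN conjunct1] by simp
  show "\<And>A. A \<in> p \<Longrightarrow> \<exists>B\<in>p. \<exists>V\<in>N. B <#> V \<subseteq> A"
    using tail[THEN conjunct2, THEN conjunct2, THEN conjunct2] by simp
qed

lemma points_carrier: "p \<in> points \<Longrightarrow> A \<in> p \<Longrightarrow> a \<in> A \<Longrightarrow> a \<in> carrier G"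
  using pointsD(1) by blast

lemma points_inhabited: "p \<in> points \<Longrightarrow> A \<in> p \<Longrightarrow> \<exists>a. a \<in> A"
  using pointsD(3) by (metis ex_in_conv)

text \<open>A set \<open>C \<in> q\<close> that is small of order \<open>V\<close> and meets
  \<open>B\<close> in \<open>b\<close> lies in \<open>b V\<close>, hence in \<open>B <#> V\<close>
  and in \<open>A\<close>.\<close>

lemma points_subset_of_meeting:
  assumes p: "p \<in> points" and q: "q \<in> points"
    and meet: "\<And>A B. A \<in> p \<Longrightarrow> B \<in> q \<Longrightarrow> A \<inter> B \<noteq> {}"
  shows "p \<subseteq> q"
proof
  fix A assume A: "A \<in> p"
  obtain B V where B: "B \<in> p" and V: "V \<in> N" and BV: "B <#> V \<subseteq> A"
    using pointsD(7)[OF p A] by blast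
  obtain C where C: "C \<in> q" "\<forall>a\<in>C. \<forall>b\<in>C. small V a b"
    using pointsD(6)[OF q V] by blast
  obtain b where b: "b \<in> B" "b \<in> C" using meet[OF B C(1)] by blast
  have "c \<in> A" if c: "c \<in> C" for c
  proof -
    have "inv b \<otimes> c \<in> V" using C(2) b c by (simp add: small_def)
    moreover have "c = b \<otimes> (inv b \<otimes> c)"
      using points_carrier[OF q C(1)] b c by (simp add: inv_cancel)
    ultimately have "c \<in> B <#> V" using b unfolding set_mult_def by blast
    then show ?thesis using BV by blast
  qed
  then show "A \<in> q" using pointsD(5)[OF q C(1)] pointsD(1)[OF p A] by blast
qed

text \<open>Round Cauchy filters are minimal: if \<open>p \<subseteq> q\<close>, then members of the
  two always meet, and the previous lemma gives the other inclusion. Every identity between points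
  below therefore needs one inclusion only.\<close>

lemma points_eqI:
  assumes "p \<in> points" "q \<in> points" "p \<subseteq> q"
  shows "p = q"
proof
  show "q \<subseteq> p"
  proof (rule points_subset_of_meeting)
    fix A B assume "A \<in> q" "B \<in> p"
    then have "A \<inter> B \<in> q" using assms by (simp add: pointsD(4) subset_iff)
    then show "A \<inter> B \<noteq> {}" using pointsD(3)[OF assms(2)] by metis
  qed (use assms in simp_all)
qed fact

text \<open>Writing \<open>c = d (d\<^sup>-\<^sup>1 c)\<close> reduces conjugation by the elements \<open>c\<close> of a small set to conjugation
  by a single element \<open>d\<close>.\<close>

lemma conj_uniform:
  assumes p: "p \<in> points" and V: "V \<in> N"
  obtains C W where "C \<in> p" "W \<in> N" "\<And>c w. c \<in> C \<Longrightarrow> w \<in> W \<Longrightarrow> inv c \<otimes> w \<otimes> c \<in> V"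
    "\<And>c w. c \<in> C \<Longrightarrow> w \<in> W \<Longrightarrow> c \<otimes> w \<otimes> inv c \<in> V"
proof -
  obtain U where U: "U \<in> N" "\<forall>x\<in>U. \<forall>y\<in>U. \<forall>z\<in>U. x \<otimes> y \<otimes> z \<in> V"
    using nhds_mult3[OF V] by blast
  obtain C where C: "C \<in> p" "\<forall>a\<in>C. \<forall>b\<in>C. small U a b"
    using pointsD(6)[OF p U(1)] by blast
  obtain d where d: "d \<in> C" using points_inhabited[OF p C(1)] by blast
  have dc: "d \<in> carrier G" using points_carrier[OF p C(1) d] .
  obtain W1 where W1: "W1 \<in> N" "\<forall>y\<in>W1. d \<otimes> y \<otimes> inv d \<in> U"
    using nhds_conj[OF U(1) dc] by blast
  obtain W2 where W2: "W2 \<in> N" "\<forall>y\<in>W2. inv d \<otimes> y \<otimes> inv (inv d) \<in> U"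
    using nhds_conj[OF U(1), of "inv d"] dc by blast
  show thesis
  proof
    show "C \<in> p" "W1 \<inter> W2 \<in> N" using C W1 W2 nhds_Int by auto
    fix c w assume c: "c \<in> C" and w: "w \<in> W1 \<inter> W2"
    have cc: "c \<in> carrier G" and wc: "w \<in> carrier G"
      using points_carrier[OF p C(1) c] nhds_carrier[OF W1(1)] w by auto
    have "(inv c \<otimes> d) \<otimes> (inv d \<otimes> w \<otimes> d) \<otimes> (inv d \<otimes> c) \<in> V"
      using U(2) C(2) W2(2) c d w dc by (auto simp: small_def)
    moreover have "(inv c \<otimes> d) \<otimes> (inv d \<otimes> w \<otimes> d) \<otimes> (inv d \<otimes> c) = inv c \<otimes> w \<otimes> c"
      using cc wc dc by (simp add: m_assoc inv_cancel)
    ultimately show "inv c \<otimes> w \<otimes> c \<in> V" by simp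
    have "(c \<otimes> inv d) \<otimes> (d \<otimes> w \<otimes> inv d) \<otimes> (d \<otimes> inv c) \<in> V"
      using U(2) C(2) W1(2) c d w by (auto simp: small_def)
    moreover have "(c \<otimes> inv d) \<otimes> (d \<otimes> w \<otimes> inv d) \<otimes> (d \<otimes> inv c) = c \<otimes> w \<otimes> inv c"
      using cc wc dc by (simp add: m_assoc inv_cancel)
    ultimately show "c \<otimes> w \<otimes> inv c \<in> V" by simp
  qed
qed

text \<open>Writing \<open>w c = c (c\<^sup>-\<^sup>1 w c)\<close> turns the right thickening in the
  definition of \<open>points\<close> into a left one, the conjugates being controlled uniformly by
  \<open>conj_uniform\<close>.\<close>

lemma points_left_round:
  assumes p: "p \<in> points" and A: "A \<in> p"
  shows "\<exists>B\<in>p. \<exists>V\<in>N. V <#> B \<subseteq> A"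
proof -
  obtain B V where B: "B \<in> p" and V: "V \<in> N" and BV: "B <#> V \<subseteq> A"
    using pointsD(7)[OF p A] by blast
  obtain C W where C: "C \<in> p" "W \<in> N" "\<And>c w. c \<in> C \<Longrightarrow> w \<in> W \<Longrightarrow> inv c \<otimes> w \<otimes> c \<in> V"
    using conj_uniform[OF p V] by metis
  have "W <#> (B \<inter> C) \<subseteq> A"
  proof
    fix x assume "x \<in> W <#> (B \<inter> C)"
    then obtain w c where wc: "w \<in> W" "c \<in> B" "c \<in> C" "x = w \<otimes> c" by (auto simp: set_mult_def)
    moreover have "x = c \<otimes> (inv c \<otimes> w \<otimes> c)"
      using wc points_carrier[OF p B] nhds_carrier[OF C(2)] by (simp add: m_assoc inv_cancel)
    ultimately have "x \<in> B <#> V" using C(3) unfolding set_mult_def by blast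
    then show "x \<in> A" using BV by blast
  qed
  then show ?thesis using pointsD(4)[OF p B C(1)] C(2) by blast
qed

section \<open>The group of points\<close>

definition point_mult :: "'a set set \<Rightarrow> 'a set set \<Rightarrow> 'a set set" where
  "point_mult p q = {A. A \<subseteq> carrier G \<and> (\<exists>B\<in>p. \<exists>C\<in>q. B <#> C \<subseteq> A)}"

definition point_inv :: "'a set set \<Rightarrow> 'a set set" where
  "point_inv p = {A. A \<subseteq> carrier G \<and> (\<exists>B\<in>p. m_inv G ` B \<subseteq> A)}"

definition completion :: "'a set set monoid" where
  "completion = \<lparr>carrier = points, mult = point_mult, one = N\<rparr>"

text \<open>This is the neighbourhood filter of \<open>x\<close>. For \<open>x = \<one>\<close> it
  is \<open>N\<close>, which is why \<open>N\<close> serves as the unit of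
  \<open>completion\<close>.\<close>

definition embed :: "'a \<Rightarrow> 'a set set" where
  "embed x = {A. A \<subseteq> carrier G \<and> (\<exists>V\<in>N. x <# V \<subseteq> A)}"

lemma point_multI:
  "A \<subseteq> carrier G \<Longrightarrow> B \<in> p \<Longrightarrow> C \<in> q \<Longrightarrow> B <#> C \<subseteq> A \<Longrightarrow> A \<in> point_mult p q"
  unfolding point_mult_def by blast

lemma point_multE:
  assumes "A \<in> point_mult p q"
  obtains B C where "A \<subseteq> carrier G" "B \<in> p" "C \<in> q" "B <#> C \<subseteq> A"
  using assms unfolding point_mult_def by blast

lemma point_invI: "A \<subseteq> carrier G \<Longrightarrow> B \<in> p \<Longrightarrow> m_inv G ` B \<subseteq> A \<Longrightarrow> A \<in> point_inv p"
  unfolding point_inv_def by blast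

lemma point_invE:
  assumes "A \<in> point_inv p"
  obtains B where "A \<subseteq> carrier G" "B \<in> p" "m_inv G ` B \<subseteq> A"
  using assms unfolding point_inv_def by blast

lemma embedI: "A \<subseteq> carrier G \<Longrightarrow> V \<in> N \<Longrightarrow> x <# V \<subseteq> A \<Longrightarrow> A \<in> embed x"
  unfolding embed_def by blast

lemma embedE:
  assumes "A \<in> embed x"
  obtains V where "A \<subseteq> carrier G" "V \<in> N" "x <# V \<subseteq> A"
  using assms unfolding embed_def by blast

lemma set_mult_in_point_mult:
  assumes "p \<in> points" "q \<in> points" "B \<in> p" "C \<in> q"
  shows "B <#> C \<in> point_mult p q"
  using assms set_mult_closed[of B C] pointsD(1) unfolding point_mult_def by blast

text \<open>For the Cauchy property, the left quotient of \<open>b c\<close> and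
  \<open>b' c'\<close> is a conjugate by \<open>c\<close> of the left quotient of \<open>b\<close>
  and \<open>b'\<close>, times that of \<open>c\<close> and \<open>c'\<close>; the right quotient
  similarly involves a conjugate by \<open>b\<close>. Both conjugations are controlled by
  \<open>conj_uniform\<close>. Roundness is inherited from \<open>q\<close>.\<close>

lemma point_mult_closed:
  assumes p: "p \<in> points" and q: "q \<in> points"
  shows "point_mult p q \<in> points"
proof (rule pointsI)
  show "A \<subseteq> carrier G" if "A \<in> point_mult p q" for A using that by (simp add: point_mult_def)
  have "carrier G <#> carrier G \<subseteq> carrier G" by (simp add: set_mult_closed)
  then show "carrier G \<in> point_mult p q"
    using pointsD(2)[OF p] pointsD(2)[OF q] unfolding point_mult_def by blast
  show "{} \<notin> point_mult p q"
  proof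
    assume "{} \<in> point_mult p q"
    then obtain B C where "B \<in> p" "C \<in> q" "B <#> C \<subseteq> {}" by (auto simp: point_mult_def)
    then show False using points_inhabited[OF p] points_inhabited[OF q] by (fastforce simp: set_mult_def)
  qed
  show "A \<inter> A' \<in> point_mult p q" if "A \<in> point_mult p q" "A' \<in> point_mult p q" for A A'
  proof -
    obtain B C where BC: "A \<subseteq> carrier G" "B \<in> p" "C \<in> q" "B <#> C \<subseteq> A"
      using \<open>A \<in> point_mult p q\<close> by (rule point_multE)
    obtain B' C' where BC': "A' \<subseteq> carrier G" "B' \<in> p" "C' \<in> q" "B' <#> C' \<subseteq> A'"
      using \<open>A' \<in> point_mult p q\<close> by (rule point_multE)
    have "(B \<inter> B') <#> (C \<inter> C') \<subseteq> A \<inter> A'" using BC(4) BC'(4) by (auto simp: set_mult_def)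
    with BC BC' show ?thesis
      using pointsD(4)[OF p] pointsD(4)[OF q] by (intro point_multI[of _ "B \<inter> B'" _ "C \<inter> C'"]) auto
  qed
  show "B \<in> point_mult p q" if "A \<in> point_mult p q" "A \<subseteq> B" "B \<subseteq> carrier G" for A B
    using that unfolding point_mult_def by blast
  show "\<exists>C\<in>point_mult p q. \<forall>a\<in>C. \<forall>b\<in>C. small V a b" if V: "V \<in> N" for V
  proof -
    obtain W where W: "W \<in> N" "\<forall>x\<in>W. \<forall>y\<in>W. x \<otimes> y \<in> V" using nhds_mult[OF V] by blast
    obtain B0 U where B0: "B0 \<in> p" "U \<in> N" "\<And>c w. c \<in> B0 \<Longrightarrow> w \<in> U \<Longrightarrow> c \<otimes> w \<otimes> inv c \<in> W"
      using conj_uniform[OF p W(1)] by metis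
    obtain C0 U' where C0: "C0 \<in> q" "U' \<in> N" "\<And>c w. c \<in> C0 \<Longrightarrow> w \<in> U' \<Longrightarrow> inv c \<otimes> w \<otimes> c \<in> W"
      using conj_uniform[OF q W(1)] by metis
    \<comment> \<open>\<open>U\<close> and \<open>U'\<close> serve the quotients that get conjugated
      into \<open>W\<close>, and \<open>W\<close> those that enter the product directly.\<close>
    define T where "T = U \<inter> U' \<inter> W"
    have T: "T \<in> N" unfolding T_def using W(1) B0(2) C0(2) by (simp add: nhds_Int)
    obtain B where B: "B \<in> p" "\<forall>a\<in>B. \<forall>b\<in>B. small T a b" using pointsD(6)[OF p T] by blast
    obtain C where C: "C \<in> q" "\<forall>a\<in>C. \<forall>b\<in>C. small T a b" using pointsD(6)[OF q T] by blast
    have "small V x y" if xy: "x \<in> (B \<inter> B0) <#> (C \<inter> C0)" "y \<in> (B \<inter> B0) <#> (C \<inter> C0)" for x y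
    proof -
      obtain b c b' c' where *: "b \<in> B" "b \<in> B0" "c \<in> C" "c \<in> C0" "x = b \<otimes> c"
         "b' \<in> B" "b' \<in> B0" "c' \<in> C" "c' \<in> C0" "y = b' \<otimes> c'"
        using xy by (auto simp: set_mult_def)
      have G: "b \<in> carrier G" "b' \<in> carrier G" "c \<in> carrier G" "c' \<in> carrier G"
        using points_carrier[OF p B(1)] points_carrier[OF q C(1)] * by auto
      have "inv b \<otimes> b' \<in> T" "b \<otimes> inv b' \<in> T" "inv c \<otimes> c' \<in> T" "c \<otimes> inv c' \<in> T"
        using B(2) C(2) * by (auto simp: small_def)
      then have "(inv c \<otimes> (inv b \<otimes> b') \<otimes> c) \<otimes> (inv c \<otimes> c') \<in> V"
        "(b \<otimes> (c \<otimes> inv c') \<otimes> inv b) \<otimes> (b \<otimes> inv b') \<in> V"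
        using W(2) B0(3) C0(3) * by (auto simp: T_def)
      then show ?thesis
        using G * by (simp add: small_def m_assoc inv_cancel inv_mult_group)
    qed
    then show ?thesis
      using set_mult_in_point_mult[OF p q] pointsD(4)[OF p B(1) B0(1)] pointsD(4)[OF q C(1) C0(1)]
      by blast
  qed
  show "\<exists>B\<in>point_mult p q. \<exists>V\<in>N. B <#> V \<subseteq> A" if "A \<in> point_mult p q" for A
  proof -
    obtain B C where BC: "A \<subseteq> carrier G" "B \<in> p" "C \<in> q" "B <#> C \<subseteq> A" using \<open>A \<in> point_mult p q\<close> by (rule point_multE)
    obtain D V where D: "D \<in> q" "V \<in> N" "D <#> V \<subseteq> C" using pointsD(7)[OF q BC(3)] by blast
    have "(B <#> D) <#> V = B <#> (D <#> V)"
      using pointsD(1)[OF p BC(2)] pointsD(1)[OF q D(1)] nhds_subset[OF D(2)]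
      by (simp add: set_mult_assoc)
    also have "\<dots> \<subseteq> A" using D(3) BC(4) by (fastforce simp: set_mult_def)
    finally show ?thesis using set_mult_in_point_mult[OF p q BC(2) D(1)] D(2) by blast
  qed
qed

text \<open>Inversion exchanges the two halves of \<open>small\<close>, so the Cauchy property
  carries over; right roundness of the inverse filter is left roundness of \<open>p\<close>.\<close>

lemma point_inv_closed:
  assumes p: "p \<in> points"
  shows "point_inv p \<in> points"
proof (rule pointsI)
  have inI: "m_inv G ` B \<in> point_inv p" if "B \<in> p" for B
    using that pointsD(1)[OF p] unfolding point_inv_def by auto
  show "A \<subseteq> carrier G" if "A \<in> point_inv p" for A using that by (simp add: point_inv_def)
  show "carrier G \<in> point_inv p"
    by (rule point_invI[OF _ pointsD(2)[OF p]]) auto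
  show "{} \<notin> point_inv p"
    using points_inhabited[OF p] by (fastforce simp: point_inv_def)
  show "A \<inter> A' \<in> point_inv p" if "A \<in> point_inv p" "A' \<in> point_inv p" for A A'
  proof -
    obtain B where B: "A \<subseteq> carrier G" "B \<in> p" "m_inv G ` B \<subseteq> A"
      using \<open>A \<in> point_inv p\<close> by (rule point_invE)
    obtain B' where B': "A' \<subseteq> carrier G" "B' \<in> p" "m_inv G ` B' \<subseteq> A'"
      using \<open>A' \<in> point_inv p\<close> by (rule point_invE)
    from B B' show ?thesis
      using pointsD(4)[OF p] by (intro point_invI[of _ "B \<inter> B'"]) auto
  qed
  show "B \<in> point_inv p" if "A \<in> point_inv p" "A \<subseteq> B" "B \<subseteq> carrier G" for A B
    using that unfolding point_inv_def by blast
  show "\<exists>C\<in>point_inv p. \<forall>a\<in>C. \<forall>b\<in>C. small V a b" if V: "V \<in> N" for V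
  proof -
    obtain C where C: "C \<in> p" "\<forall>a\<in>C. \<forall>b\<in>C. small V a b" using pointsD(6)[OF p V] by blast
    then have "\<forall>a\<in>m_inv G ` C. \<forall>b\<in>m_inv G ` C. small V a b"
      using points_carrier[OF p C(1)] by (auto simp: small_def)
    then show ?thesis using inI[OF C(1)] by blast
  qed
  show "\<exists>B\<in>point_inv p. \<exists>V\<in>N. B <#> V \<subseteq> A" if "A \<in> point_inv p" for A
  proof -
    obtain B where B: "A \<subseteq> carrier G" "B \<in> p" "m_inv G ` B \<subseteq> A" using \<open>A \<in> point_inv p\<close> by (rule point_invE)
    obtain C V where C: "C \<in> p" "V \<in> N" "V <#> C \<subseteq> B" using points_left_round[OF p B(2)] by blast
    obtain W where W: "W \<in> N" "\<forall>x\<in>W. inv x \<in> V" using nhds_inv[OF C(2)] by blast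
    have "m_inv G ` C <#> W \<subseteq> A"
    proof
      fix x assume "x \<in> m_inv G ` C <#> W"
      then obtain c w where *: "c \<in> C" "w \<in> W" "x = inv c \<otimes> w" by (auto simp: set_mult_def)
      then have "inv w \<otimes> c \<in> B" using W C(3) by (fastforce simp: set_mult_def)
      moreover have "x = inv (inv w \<otimes> c)"
        using * points_carrier[OF p C(1)] nhds_carrier[OF W(1)] by (simp add: inv_mult_group)
      ultimately show "x \<in> A" using B(3) by blast
    qed
    then show ?thesis using inI[OF C(1)] W(1) by blast
  qed
qed

lemma embed_in_points:
  assumes x: "x \<in> carrier G"
  shows "embed x \<in> points"
proof (rule pointsI)
  have inI: "x <# V \<in> embed x" if "V \<in> N" for V
    using that nhds_subset[OF that] x by (auto simp: embed_def l_coset_def)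
  show "A \<subseteq> carrier G" if "A \<in> embed x" for A using that by (simp add: embed_def)
  show "carrier G \<in> embed x"
    using x by (intro embedI[OF _ carrier_nhds] l_coset_subset_G) auto
  show "{} \<notin> embed x"
    using one_mem_nhds by (fastforce simp: embed_def l_coset_def)
  show "A \<inter> A' \<in> embed x" if "A \<in> embed x" "A' \<in> embed x" for A A'
  proof -
    obtain V where V: "A \<subseteq> carrier G" "V \<in> N" "x <# V \<subseteq> A"
      using \<open>A \<in> embed x\<close> by (rule embedE)
    obtain V' where V': "A' \<subseteq> carrier G" "V' \<in> N" "x <# V' \<subseteq> A'"
      using \<open>A' \<in> embed x\<close> by (rule embedE)
    have "x <# (V \<inter> V') \<subseteq> A \<inter> A'" using V(3) V'(3) by (auto simp: l_coset_def)
    with V V' show ?thesis by (intro embedI[of _ "V \<inter> V'"]) (auto simp: nhds_Int)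
  qed
  show "B \<in> embed x" if "A \<in> embed x" "A \<subseteq> B" "B \<subseteq> carrier G" for A B
    using that unfolding embed_def by blast
  show "\<exists>C\<in>embed x. \<forall>a\<in>C. \<forall>b\<in>C. small V a b" if V: "V \<in> N" for V
  proof -
    \<comment> \<open>The left quotient of \<open>x v\<close> and \<open>x w\<close> is
      \<open>v\<^sup>-\<^sup>1 w\<close>, handled by \<open>V4\<close>; the right quotient is
      \<open>x (v w\<^sup>-\<^sup>1) x\<^sup>-\<^sup>1\<close>, handled by \<open>V1\<close>,
      \<open>V2\<close> and \<open>V3\<close>.\<close>
    obtain V1 where V1: "V1 \<in> N" "\<forall>y\<in>V1. x \<otimes> y \<otimes> inv x \<in> V" using nhds_conj[OF V x] by blast
    obtain V2 where V2: "V2 \<in> N" "\<forall>y\<in>V2. \<forall>z\<in>V2. y \<otimes> z \<in> V1" using nhds_mult[OF V1(1)] by blast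
    obtain V3 where V3: "V3 \<in> N" "\<forall>y\<in>V3. inv y \<in> V2" using nhds_inv[OF V2(1)] by blast
    obtain V4 where V4: "V4 \<in> N" "\<forall>y\<in>V4. \<forall>z\<in>V4. inv y \<otimes> z \<in> V" using nhds_div[OF V] by blast
    define W where "W = V2 \<inter> V3 \<inter> V4"
    have W: "W \<in> N" using V2(1) V3(1) V4(1) unfolding W_def by (simp add: nhds_Int)
    have "small V a b" if "a \<in> x <# W" "b \<in> x <# W" for a b
    proof -
      obtain v w where *: "v \<in> W" "w \<in> W" "a = x \<otimes> v" "b = x \<otimes> w"
        using \<open>a \<in> x <# W\<close> \<open>b \<in> x <# W\<close> unfolding l_coset_def by blast
      have "v \<in> carrier G" "w \<in> carrier G" using * nhds_carrier[OF W] by auto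
      moreover have "inv v \<otimes> w \<in> V" using * V4 by (auto simp: W_def)
      moreover have "x \<otimes> (v \<otimes> inv w) \<otimes> inv x \<in> V" using * V1 V2 V3 by (auto simp: W_def)
      ultimately show ?thesis using x * by (simp add: small_def m_assoc inv_cancel inv_mult_group)
    qed
    then show ?thesis using inI[OF W] by blast
  qed
  show "\<exists>B\<in>embed x. \<exists>V\<in>N. B <#> V \<subseteq> A" if "A \<in> embed x" for A
  proof -
    obtain V where V: "A \<subseteq> carrier G" "V \<in> N" "x <# V \<subseteq> A" using \<open>A \<in> embed x\<close> by (rule embedE)
    obtain W where W: "W \<in> N" "\<forall>y\<in>W. \<forall>z\<in>W. y \<otimes> z \<in> V" using nhds_mult[OF V(2)] by blast
    have "(x <# W) <#> W \<subseteq> x <# V"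
      using W nhds_carrier[OF W(1)] x by (fastforce simp: l_coset_def set_mult_def m_assoc)
    then show ?thesis using V(3) inI[OF W(1)] W(1) by blast
  qed
qed

lemma embed_one: "embed \<one> = N"
proof -
  have *: "\<one> <# V = V" if "V \<in> N" for V
    using nhds_carrier[OF that] by (auto simp: l_coset_def)
  show ?thesis
  proof (rule subset_antisym; rule subsetI)
    fix A assume "A \<in> embed \<one>"
    then obtain V where "A \<subseteq> carrier G" "V \<in> N" "\<one> <# V \<subseteq> A" by (rule embedE)
    then show "A \<in> N" using nhds_mono * by simp
  next
    fix A assume "A \<in> N"
    then show "A \<in> embed \<one>" using * nhds_subset by (intro embedI[of A A]) simp_all
  qed
qed

lemma point_mult_assoc:
  assumes "p \<in> points" "q \<in> points" "r \<in> points"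
  shows "point_mult (point_mult p q) r = point_mult p (point_mult q r)"
proof (rule points_eqI)
  show "point_mult (point_mult p q) r \<in> points" "point_mult p (point_mult q r) \<in> points"
    using assms by (simp_all add: point_mult_closed)
  show "point_mult (point_mult p q) r \<subseteq> point_mult p (point_mult q r)"
  proof
    fix A assume "A \<in> point_mult (point_mult p q) r"
    then obtain B C D where *: "A \<subseteq> carrier G" "B \<in> p" "C \<in> q" "D \<in> r" "(B <#> C) <#> D \<subseteq> A"
      by (fastforce simp: point_mult_def set_mult_def)
    then have "B <#> (C <#> D) \<subseteq> A" using assms pointsD(1) by (simp flip: set_mult_assoc)
    moreover have "C <#> D \<in> point_mult q r" using * assms by (simp add: set_mult_in_point_mult)
    ultimately show "A \<in> point_mult p (point_mult q r)"
      using * unfolding point_mult_def[of p] by blast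
  qed
qed

lemma nhds_in_points: "N \<in> points"
  using embed_in_points[of \<one>] by (simp add: embed_one)

text \<open>If \<open>C \<in> p\<close> is small of order \<open>V\<close>, then the products
  \<open>a\<^sup>-\<^sup>1 b\<close> with \<open>a, b \<in> C\<close> lie in \<open>V\<close>, so
  \<open>V\<close> belongs to the product filter. By minimality this one inclusion is
  enough.\<close>

lemma point_mult_inv:
  assumes p: "p \<in> points"
  shows "point_mult (point_inv p) p = N"
proof (rule points_eqI[symmetric])
  show "N \<in> points" "point_mult (point_inv p) p \<in> points"
    using p by (simp_all add: nhds_in_points point_mult_closed point_inv_closed)
  show "N \<subseteq> point_mult (point_inv p) p"
  proof
    fix V assume V: "V \<in> N"
    then obtain C where C: "C \<in> p" "\<forall>a\<in>C. \<forall>b\<in>C. small V a b" using pointsD(6)[OF p] by blast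
    have "m_inv G ` C \<in> point_inv p"
      using C(1) pointsD(1)[OF p C(1)] by (intro point_invI[of _ C]) auto
    moreover have "m_inv G ` C <#> C \<subseteq> V" using C(2) by (auto simp: set_mult_def small_def)
    ultimately show "V \<in> point_mult (point_inv p) p"
      using C(1) nhds_subset[OF V] by (intro point_multI)
  qed
qed

lemma group_completion: "group completion"
proof (rule groupI)
  note N = nhds_in_points
  show "\<one>\<^bsub>completion\<^esub> \<in> carrier completion" using N by (simp add: completion_def)
  fix p assume "p \<in> carrier completion"
  then have p: "p \<in> points" by (simp add: completion_def)
  have "point_mult N p \<subseteq> p"
  proof
    fix A assume "A \<in> point_mult N p"
    then obtain V B where *: "A \<subseteq> carrier G" "V \<in> N" "B \<in> p" "V <#> B \<subseteq> A"
      by (auto simp: point_mult_def)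
    have "B \<subseteq> V <#> B"
    proof
      fix b assume b: "b \<in> B"
      then have "b = \<one> \<otimes> b" using points_carrier[OF p *(3)] by simp
      then show "b \<in> V <#> B" using b one_mem_nhds[OF *(2)] unfolding set_mult_def by blast
    qed
    then show "A \<in> p" using * pointsD(5)[OF p *(3)] by blast
  qed
  then have "point_mult N p = p" using points_eqI[OF point_mult_closed[OF N p] p] by simp
  then show "\<one>\<^bsub>completion\<^esub> \<otimes>\<^bsub>completion\<^esub> p = p" by (simp add: completion_def)
  show "\<exists>q\<in>carrier completion. q \<otimes>\<^bsub>completion\<^esub> p = \<one>\<^bsub>completion\<^esub>"
    using point_inv_closed[OF p] point_mult_inv[OF p] by (auto simp: completion_def)
qed (simp_all add: completion_def point_mult_closed point_mult_assoc)

lemma inv_completion: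
  assumes p: "p \<in> points"
  shows "inv\<^bsub>completion\<^esub> p = point_inv p"
proof -
  interpret K: group completion by (rule group_completion)
  show ?thesis
    using p point_inv_closed[OF p] point_mult_inv[OF p]
    by (intro K.inv_equality) (simp_all add: completion_def)
qed

lemma embed_mult:
  assumes x: "x \<in> carrier G" and y: "y \<in> carrier G"
  shows "embed (x \<otimes> y) = point_mult (embed x) (embed y)"
proof (rule points_eqI[symmetric])
  show "embed (x \<otimes> y) \<in> points" "point_mult (embed x) (embed y) \<in> points"
    using x y by (simp_all add: embed_in_points point_mult_closed)
  show "point_mult (embed x) (embed y) \<subseteq> embed (x \<otimes> y)"
  proof
    fix A assume "A \<in> point_mult (embed x) (embed y)"
    then obtain B C V W where *: "A \<subseteq> carrier G" "B <#> C \<subseteq> A" "V \<in> N" "x <# V \<subseteq> B" "W \<in> N" "y <# W \<subseteq> C"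
      by (auto simp: point_mult_def embed_def)
    \<comment> \<open>Only the element \<open>x\<close> of \<open>B\<close> is kept, so the
      remaining translate is \<open>x y W\<close>; no conjugation occurs in this inclusion.\<close>
    have "x \<otimes> \<one> \<in> B" using *(4) one_mem_nhds[OF *(3)] unfolding l_coset_def by blast
    then have "x \<in> B" using x by simp
    have "x \<otimes> y \<otimes> w \<in> A" if "w \<in> W" for w
    proof -
      have "y \<otimes> w \<in> C" using *(6) that by (auto simp: l_coset_def)
      then have "x \<otimes> (y \<otimes> w) \<in> A" using \<open>x \<in> B\<close> *(2) by (auto simp: set_mult_def)
      then show ?thesis using x y nhds_carrier[OF *(5) that] by (simp add: m_assoc)
    qed
    then have "(x \<otimes> y) <# W \<subseteq> A" by (auto simp: l_coset_def)
    then show "A \<in> embed (x \<otimes> y)" using * by (auto simp: embed_def)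
  qed
qed

lemma embed_hom: "embed \<in> hom G completion"
  by (rule homI) (simp_all add: completion_def embed_in_points embed_mult)

section \<open>The topology of the completion\<close>

definition basic_open :: "'a set \<Rightarrow> 'a set set set" where
  "basic_open A = {p \<in> points. A \<in> p}"

text \<open>The sets \<open>basic_open A\<close> form a base: a point \<open>p\<close> lies in
  \<open>basic_open A\<close> as soon as \<open>A \<in> p\<close>, and the basic sets of
  \<open>A\<close> and \<open>B\<close> intersect in that of \<open>A \<inter> B\<close>.\<close>

definition completion_topology :: "'a set set topology" where
  "completion_topology = topology (\<lambda>U. U \<subseteq> points \<and> (\<forall>p\<in>U. \<exists>A\<in>p. basic_open A \<subseteq> U))"

lemma openin_completion_topology:
  "openin completion_topology U \<longleftrightarrow> U \<subseteq> points \<and> (\<forall>p\<in>U. \<exists>A\<in>p. basic_open A \<subseteq> U)"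
proof -
  have "istopology (\<lambda>U. U \<subseteq> points \<and> (\<forall>p\<in>U. \<exists>A\<in>p. basic_open A \<subseteq> U))"
    unfolding istopology_def
  proof (intro conjI allI impI)
    fix S T
    assume S: "S \<subseteq> points \<and> (\<forall>p\<in>S. \<exists>A\<in>p. basic_open A \<subseteq> S)"
      and T: "T \<subseteq> points \<and> (\<forall>p\<in>T. \<exists>A\<in>p. basic_open A \<subseteq> T)"
    show "S \<inter> T \<subseteq> points" using S by blast
    show "\<forall>p\<in>S \<inter> T. \<exists>A\<in>p. basic_open A \<subseteq> S \<inter> T"
    proof
      fix p assume p: "p \<in> S \<inter> T"
      obtain A where A: "A \<in> p" "basic_open A \<subseteq> S" using p S by blast
      obtain B where B: "B \<in> p" "basic_open B \<subseteq> T" using p T by blast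
      note AB = A B
      have pp: "p \<in> points" using p S by blast
      have "basic_open (A \<inter> B) \<subseteq> S \<inter> T"
      proof
        fix q assume "q \<in> basic_open (A \<inter> B)"
        then have q: "q \<in> points" "A \<inter> B \<in> q" by (auto simp: basic_open_def)
        then have "A \<in> q" "B \<in> q"
          using pointsD(5)[OF q] pointsD(1)[OF pp] AB by blast+
        then show "q \<in> S \<inter> T" using q AB by (auto simp: basic_open_def)
      qed
      then show "\<exists>A\<in>p. basic_open A \<subseteq> S \<inter> T" using pointsD(4)[OF pp] AB by blast
    qed
  next
    fix \<K> assume K: "\<forall>S\<in>\<K>. S \<subseteq> points \<and> (\<forall>p\<in>S. \<exists>A\<in>p. basic_open A \<subseteq> S)"
    then show "\<Union>\<K> \<subseteq> points" by blast
    show "\<forall>p\<in>\<Union>\<K>. \<exists>A\<in>p. basic_open A \<subseteq> \<Union>\<K>"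
    proof
      fix p assume "p \<in> \<Union>\<K>"
      then obtain S where S: "S \<in> \<K>" "p \<in> S" by blast
      then obtain A where "A \<in> p" "basic_open A \<subseteq> S" using K by blast
      then show "\<exists>A\<in>p. basic_open A \<subseteq> \<Union>\<K>" using S by blast
    qed
  qed
  then show ?thesis by (simp add: completion_topology_def)
qed

lemma openin_basic_open: "openin completion_topology (basic_open A)"
  unfolding openin_completion_topology basic_open_def by auto

lemma topspace_completion: "topspace completion_topology = points"
proof -
  have "openin completion_topology points"
    unfolding openin_completion_topology basic_open_def using pointsD(2) by blast
  then have "points \<subseteq> topspace completion_topology" by (rule openin_subset)
  moreover have "topspace completion_topology \<subseteq> points"
    using openin_topspace[of completion_topology] unfolding openin_completion_topology by blast
  ultimately show ?thesis by blast
qed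

lemma topological_group_completion: "topological_group completion completion_topology"
proof (intro topological_group.intro topological_group_axioms.intro)
  show "group completion" by (rule group_completion)
  show "topspace completion_topology = carrier completion"
    by (simp add: topspace_completion completion_def)
  show "continuous_map completion_topology completion_topology (m_inv completion)"
    unfolding continuous_map_def
  proof (intro conjI allI impI)
    show "m_inv completion \<in> topspace completion_topology \<rightarrow> topspace completion_topology"
      by (simp add: topspace_completion inv_completion point_inv_closed)
    fix U assume U: "openin completion_topology U"
    show "openin completion_topology {p \<in> topspace completion_topology. inv\<^bsub>completion\<^esub> p \<in> U}"
      unfolding openin_completion_topology
    proof (intro conjI ballI)
      show "{p \<in> topspace completion_topology. inv\<^bsub>completion\<^esub> p \<in> U} \<subseteq> points"
        by (auto simp: topspace_completion)
      fix p assume "p \<in> {p \<in> topspace completion_topology. inv\<^bsub>completion\<^esub> p \<in> U}"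
      then have p: "p \<in> points" "point_inv p \<in> U" by (auto simp: topspace_completion inv_completion)
      then obtain A where A: "A \<in> point_inv p" "basic_open A \<subseteq> U"
        using U unfolding openin_completion_topology by blast
      then obtain B where B: "A \<subseteq> carrier G" "B \<in> p" "m_inv G ` B \<subseteq> A" by (auto simp: point_inv_def)
      have "basic_open B \<subseteq> {p \<in> topspace completion_topology. inv\<^bsub>completion\<^esub> p \<in> U}"
      proof
        fix q assume "q \<in> basic_open B"
        then have q: "q \<in> points" "B \<in> q" by (auto simp: basic_open_def)
        then have "A \<in> point_inv q" using B by (auto simp: point_inv_def)
        then have "point_inv q \<in> U" using A q point_inv_closed by (auto simp: basic_open_def)
        then show "q \<in> {p \<in> topspace completion_topology. inv\<^bsub>completion\<^esub> p \<in> U}"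
          using q by (simp add: topspace_completion inv_completion)
      qed
      then show "\<exists>A\<in>p. basic_open A \<subseteq> {p \<in> topspace completion_topology. inv\<^bsub>completion\<^esub> p \<in> U}"
        using B by blast
    qed
  qed
  have mult: "(\<lambda>(x, y). x \<otimes>\<^bsub>completion\<^esub> y) = (\<lambda>(p, q). point_mult p q)"
    by (simp add: completion_def)
  show "continuous_map (prod_topology completion_topology completion_topology) completion_topology
          (\<lambda>(x, y). x \<otimes>\<^bsub>completion\<^esub> y)"
    unfolding mult continuous_map_def topspace_prod_topology topspace_completion
  proof (intro conjI allI impI)
    show "(\<lambda>(p, q). point_mult p q) \<in> points \<times> points \<rightarrow> points" by (auto simp: point_mult_closed)
    fix U assume U: "openin completion_topology U"
    show "openin (prod_topology completion_topology completion_topology)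
            {x \<in> points \<times> points. (case x of (p, q) \<Rightarrow> point_mult p q) \<in> U}"
      unfolding openin_prod_topology_alt
    proof (intro allI impI)
      fix p q assume "(p, q) \<in> {x \<in> points \<times> points. (case x of (p, q) \<Rightarrow> point_mult p q) \<in> U}"
      then have pq: "p \<in> points" "q \<in> points" "point_mult p q \<in> U" by auto
      then obtain A where A: "A \<in> point_mult p q" "basic_open A \<subseteq> U"
        using U unfolding openin_completion_topology by blast
      then obtain B C where BC: "A \<subseteq> carrier G" "B \<in> p" "C \<in> q" "B <#> C \<subseteq> A"
        by (auto simp: point_mult_def)
      have "point_mult p' q' \<in> U" if "p' \<in> basic_open B" "q' \<in> basic_open C" for p' q'
      proof -
        have "A \<in> point_mult p' q'" using BC that by (auto simp: point_mult_def basic_open_def)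
        then show ?thesis using A that point_mult_closed by (auto simp: basic_open_def)
      qed
      then have "basic_open B \<times> basic_open C
          \<subseteq> {x \<in> points \<times> points. (case x of (p, q) \<Rightarrow> point_mult p q) \<in> U}"
        by (auto simp: basic_open_def)
      moreover have "p \<in> basic_open B" "q \<in> basic_open C" using pq BC by (auto simp: basic_open_def)
      ultimately show "\<exists>V W. openin completion_topology V \<and> openin completion_topology W \<and> p \<in> V \<and> q \<in> W \<and>
          V \<times> W \<subseteq> {x \<in> points \<times> points. (case x of (p, q) \<Rightarrow> point_mult p q) \<in> U}"
        using openin_basic_open by blast
    qed
  qed
qed

text \<open>Distinct points contain disjoint sets by minimality, and no filter without the empty set
  contains both.\<close>

lemma Hausdorff_completion: "Hausdorff_space completion_topology"
  unfolding Hausdorff_space_def topspace_completion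
proof (intro allI impI)
  fix p q assume pq: "p \<in> points \<and> q \<in> points \<and> p \<noteq> q"
  then have "\<not> p \<subseteq> q" using points_eqI by blast
  then obtain A B where AB: "A \<in> p" "B \<in> q" "A \<inter> B = {}"
    using points_subset_of_meeting pq by meson
  then have "disjnt (basic_open A) (basic_open B)"
    using pointsD(3,4) unfolding disjnt_def basic_open_def by fastforce
  then show "\<exists>U V. openin completion_topology U \<and> openin completion_topology V \<and> p \<in> U \<and> q \<in> V \<and> disjnt U V"
    using openin_basic_open AB pq by (fastforce simp: basic_open_def)
qed

lemma basic_open_mono: "A \<subseteq> B \<Longrightarrow> B \<subseteq> carrier G \<Longrightarrow> basic_open A \<subseteq> basic_open B"
  using pointsD(5) unfolding basic_open_def by blast

text \<open>By roundness each \<open>B \<in> p\<close> contains \<open>C <#> V\<close> with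
  \<open>C \<in> p\<close>; an element \<open>a\<close> of \<open>A \<inter> C\<close> then has
  \<open>B\<close> in its neighbourhood filter. Conversely, \<open>B\<close> in the neighbourhood
  filter of \<open>a\<close> forces \<open>a \<in> B\<close>.\<close>

lemma in_closure_embed:
  assumes A: "A \<subseteq> carrier G" and p: "p \<in> points"
  shows "p \<in> completion_topology closure_of (embed ` A) \<longleftrightarrow> (\<forall>B\<in>p. A \<inter> B \<noteq> {})"
proof
  assume cl: "p \<in> completion_topology closure_of (embed ` A)"
  show "\<forall>B\<in>p. A \<inter> B \<noteq> {}"
  proof
    fix B assume B: "B \<in> p"
    then have "p \<in> basic_open B" using p by (simp add: basic_open_def)
    then obtain a where a: "a \<in> A" "embed a \<in> basic_open B"
      using cl openin_basic_open[of B] unfolding in_closure_of by blast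
    then obtain V where V: "V \<in> N" "a <# V \<subseteq> B" by (auto simp: basic_open_def embed_def)
    then have "a \<otimes> \<one> \<in> B" using one_mem_nhds unfolding l_coset_def by blast
    moreover have "a \<otimes> \<one> = a" using a(1) A by auto
    ultimately show "A \<inter> B \<noteq> {}" using a(1) by auto
  qed
next
  assume meet: "\<forall>B\<in>p. A \<inter> B \<noteq> {}"
  show "p \<in> completion_topology closure_of (embed ` A)"
    unfolding in_closure_of topspace_completion
  proof (intro conjI allI impI)
    show "p \<in> points" by fact
    fix T assume T: "p \<in> T \<and> openin completion_topology T"
    then obtain B where B: "B \<in> p" "basic_open B \<subseteq> T"
      unfolding openin_completion_topology by blast
    obtain C V where C: "C \<in> p" "V \<in> N" "C <#> V \<subseteq> B" using pointsD(7)[OF p B(1)] by blast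
    obtain a where a: "a \<in> A" "a \<in> C" using meet C(1) by blast
    then have "a <# V \<subseteq> B" using C(3) unfolding set_mult_def l_coset_def by blast
    then have "embed a \<in> basic_open B"
      using C(2) pointsD(1)[OF p B(1)] A a embed_in_points by (auto simp: embed_def basic_open_def)
    then show "\<exists>y. y \<in> embed ` A \<and> y \<in> T" using a B by blast
  qed
qed

section \<open>Compactness from total boundedness\<close>

definition precompact :: "'a set \<Rightarrow> bool" where
  "precompact A \<longleftrightarrow> A \<subseteq> carrier G \<and> (\<forall>V\<in>N. finite_cover_by (small V) A)"

text \<open>Left translation by \<open>x\<close> preserves left quotients and conjugates right
  quotients by \<open>x\<close>; hence covers of order \<open>V \<inter> W\<close> are pulled back,
  with \<open>W\<close> conjugated into \<open>V\<close>.\<close>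

lemma precompact_translate:
  assumes A: "precompact A" and x: "x \<in> carrier G"
  shows "precompact (x <# A)"
  unfolding precompact_def
proof (intro conjI ballI)
  have AG: "A \<subseteq> carrier G" using A by (simp add: precompact_def)
  then show "x <# A \<subseteq> carrier G" using x by (rule l_coset_subset_G)
  fix V assume V: "V \<in> N"
  obtain W where W: "W \<in> N" "\<forall>y\<in>W. x \<otimes> y \<otimes> inv x \<in> V" using nhds_conj[OF V x] by blast
  have "finite_cover_by (small (V \<inter> W)) A" using A nhds_Int[OF V W(1)] by (simp add: precompact_def)
  then show "finite_cover_by (small V) (x <# A)"
  proof (rule finite_cover_by_vimage)
    show "(\<lambda>y. inv x \<otimes> y) ` (x <# A) \<subseteq> A"
      using x AG by (auto simp: l_coset_def inv_cancel subset_iff)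
    fix a b assume a: "a \<in> x <# A" and b: "b \<in> x <# A"
      and s: "small (V \<inter> W) (inv x \<otimes> a) (inv x \<otimes> b)"
    have G: "a \<in> carrier G" "b \<in> carrier G" using a b l_coset_subset_G[OF AG x] by auto
    have "inv (inv x \<otimes> a) \<otimes> (inv x \<otimes> b) \<in> V" using s by (simp add: small_def)
    moreover have "x \<otimes> ((inv x \<otimes> a) \<otimes> inv (inv x \<otimes> b)) \<otimes> inv x \<in> V"
      using s W(2) by (simp add: small_def)
    ultimately show "small V a b"
      using G x by (simp add: small_def inv_mult_group m_assoc inv_cancel)
  qed
qed

text \<open>Call a set good if the basic set of some thickening of it lies in one member of the open
  cover. If no finitely many good sets covered \<open>A\<close>, an ultrafilter \<open>u\<close> on
  \<open>A\<close> would avoid them all. Total boundedness makes \<open>u\<close> Cauchy, so its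
  round version is a point of the closure; a member of the cover around that point makes some set of
  \<open>u\<close> good, a contradiction. Finitely many good sets covering \<open>A\<close> yield
  the finite subcover.\<close>

lemma compactin_closure_embed:
  assumes A: "precompact A"
  shows "compactin completion_topology (completion_topology closure_of (embed ` A))"
  unfolding compactin_def
proof (intro conjI allI impI)
  let ?K = "completion_topology closure_of (embed ` A)"
  have AG: "A \<subseteq> carrier G" using A by (simp add: precompact_def)
  show "?K \<subseteq> topspace completion_topology" by (rule closure_of_subset_topspace)
  fix \<U> assume \<U>: "Ball \<U> (openin completion_topology) \<and> ?K \<subseteq> \<Union>\<U>"
  define I where "I = {B. B \<subseteq> carrier G \<and> (\<exists>V\<in>N. \<exists>U\<in>\<U>. basic_open (B <#> V) \<subseteq> U)}"
  have "\<exists>K. finite K \<and> K \<subseteq> I \<and> A \<subseteq> \<Union>K"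
  proof (rule ccontr)
    assume "\<nexists>K. finite K \<and> K \<subseteq> I \<and> A \<subseteq> \<Union>K"
    from ultrafilter_avoiding[OF this] obtain u where u0: "A \<in> u" "{} \<notin> u"
      "\<forall>B\<in>u. \<forall>C\<in>u. B \<inter> C \<in> u" "\<forall>B\<in>u. \<forall>C. B \<subseteq> C \<longrightarrow> C \<in> u" "\<forall>B\<in>I. B \<notin> u"
      "\<forall>\<C>. finite \<C> \<and> A \<subseteq> \<Union>\<C> \<longrightarrow> (\<exists>C\<in>\<C>. C \<in> u)"
      by (elim exE conjE) (rule that)
    have u: "A \<in> u" "{} \<notin> u" "\<And>B C. B \<in> u \<Longrightarrow> C \<in> u \<Longrightarrow> B \<inter> C \<in> u"
      "\<And>B C. B \<in> u \<Longrightarrow> B \<subseteq> C \<Longrightarrow> C \<in> u" "\<And>B. B \<in> I \<Longrightarrow> B \<notin> u"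
      using u0(1-5) by simp_all
    have ultra: "\<exists>C\<in>\<C>. C \<in> u" if "finite \<C>" "A \<subseteq> \<Union>\<C>" for \<C>
      using u0(6) that by simp
    \<comment> \<open>The round filter equivalent to \<open>u\<close>, generated by the thickenings
      of its members.\<close>
    define p where "p = {S. S \<subseteq> carrier G \<and> (\<exists>B\<in>u. \<exists>V\<in>N. B \<subseteq> carrier G \<and> B <#> V \<subseteq> S)}"
    have sub: "B \<subseteq> B <#> V" if "B \<subseteq> carrier G" "V \<in> N" for B V
    proof
      fix b assume b: "b \<in> B"
      then have "b = b \<otimes> \<one>" using that by auto
      then show "b \<in> B <#> V" using b one_mem_nhds[OF that(2)] unfolding set_mult_def by blast
    qed
    have pI: "S \<in> p" if "S \<subseteq> carrier G" "B \<in> u" "B \<subseteq> carrier G" "V \<in> N" "B <#> V \<subseteq> S" for S B V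
      using that unfolding p_def by blast
    have pE: "\<exists>B V. S \<subseteq> carrier G \<and> B \<in> u \<and> B \<subseteq> carrier G \<and> V \<in> N \<and> B <#> V \<subseteq> S" if "S \<in> p" for S
      using that unfolding p_def by blast
    have pu: "S \<in> u" if S: "S \<in> p" for S
    proof -
      obtain B V where "B \<in> u" "B \<subseteq> carrier G" "V \<in> N" "B <#> V \<subseteq> S" using pE[OF S] by blast
      then show ?thesis using u(4)[of B S] sub[of B V] by blast
    qed
    have p: "p \<in> points"
    proof (rule pointsI)
      show "S \<subseteq> carrier G" if "S \<in> p" for S using that by (simp add: p_def)
      show "carrier G \<in> p"
        using u(1) AG carrier_nhds set_mult_closed[OF AG, of "carrier G"] by (intro pI[of _ A]) auto
      show "{} \<notin> p" using pu u(2) by blast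
      show "S \<inter> S' \<in> p" if "S \<in> p" "S' \<in> p" for S S'
      proof -
        obtain B V where B: "S \<subseteq> carrier G" "B \<in> u" "V \<in> N" "B \<subseteq> carrier G" "B <#> V \<subseteq> S"
          using pE[OF \<open>S \<in> p\<close>] by blast
        obtain B' V' where B': "B' \<in> u" "V' \<in> N" "B' \<subseteq> carrier G" "B' <#> V' \<subseteq> S'"
          using pE[OF \<open>S' \<in> p\<close>] by blast
        have "(B \<inter> B') <#> (V \<inter> V') \<subseteq> S \<inter> S'" using B(5) B'(4) by (auto simp: set_mult_def)
        then show ?thesis
          using B(1,4) u(3)[OF B(2) B'(1)] nhds_Int[OF B(3) B'(2)] by (intro pI[of _ "B \<inter> B'"]) auto
      qed
      show "S' \<in> p" if "S \<in> p" "S \<subseteq> S'" "S' \<subseteq> carrier G" for S S'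
        using pE[OF that(1)] that(2,3) by (blast intro: pI)
      show "\<exists>B\<in>p. \<exists>V\<in>N. B <#> V \<subseteq> S" if "S \<in> p" for S
      proof -
        obtain B V where *: "B \<in> u" "V \<in> N" "B \<subseteq> carrier G" "B <#> V \<subseteq> S"
          using pE[OF \<open>S \<in> p\<close>] by blast
        obtain W where W: "W \<in> N" "\<forall>y\<in>W. \<forall>z\<in>W. y \<otimes> z \<in> V" using nhds_mult[OF *(2)] by blast
        have "(B <#> W) <#> W = B <#> (W <#> W)"
          using * nhds_subset[OF W(1)] by (simp add: set_mult_assoc)
        also have "\<dots> \<subseteq> B <#> V" using W(2) by (fastforce simp: set_mult_def)
        finally have "(B <#> W) <#> W \<subseteq> S" using * by blast
        moreover have "B <#> W \<in> p"
          using * W(1) nhds_subset[OF W(1)] by (intro pI[of _ B W] set_mult_closed) auto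
        ultimately show ?thesis using W(1) by blast
      qed
      show "\<exists>C\<in>p. \<forall>a\<in>C. \<forall>b\<in>C. small V a b" if V: "V \<in> N" for V
      proof -
        obtain V1 where V1: "V1 \<in> N" "\<forall>x\<in>V1. \<forall>y\<in>V1. \<forall>z\<in>V1. x \<otimes> y \<otimes> z \<in> V"
          using nhds_mult3[OF V] by blast
        obtain V2 where V2: "V2 \<in> N" "\<forall>y\<in>V2. inv y \<in> V1" using nhds_inv[OF V1(1)] by blast
        have "finite_cover_by (small V1) A" using A V1 by (simp add: precompact_def)
        then obtain \<C> where \<C>: "finite \<C>" "A \<subseteq> \<Union>\<C>" "\<forall>C\<in>\<C>. \<forall>a\<in>C. \<forall>b\<in>C. small V1 a b"
          by (auto simp: finite_cover_by_def)
        \<comment> \<open>This is where total boundedness and maximality of \<open>u\<close> produce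
          a small member of \<open>u\<close>.\<close>
        obtain C where C: "C \<in> \<C>" "C \<in> u" using ultra[OF \<C>(1,2)] by blast
        define B where "B = A \<inter> C"
        have B: "B \<in> u" "B \<subseteq> carrier G" "\<forall>a\<in>B. \<forall>b\<in>B. small V1 a b"
          using C u(1,3) AG \<C>(3) by (auto simp: B_def)
        \<comment> \<open>The right quotient of \<open>b v\<close> and \<open>c w\<close> is
          \<open>(b d\<^sup>-\<^sup>1) (d v w\<^sup>-\<^sup>1 d\<^sup>-\<^sup>1) (d
          c\<^sup>-\<^sup>1)\<close>, so one conjugation by a fixed \<open>d\<close> is enough for
          all of \<open>B\<close>.\<close>
        obtain d where d: "d \<in> B" using B(1) u(2) by (metis ex_in_conv)
        have dG: "d \<in> carrier G" using d B by blast
        obtain V3 where V3: "V3 \<in> N" "\<forall>y\<in>V3. d \<otimes> y \<otimes> inv d \<in> V1"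
          using nhds_conj[OF V1(1) dG] by blast
        obtain V4 where V4: "V4 \<in> N" "\<forall>x\<in>V4. \<forall>y\<in>V4. x \<otimes> y \<in> V3" using nhds_mult[OF V3(1)] by blast
        obtain V5 where V5: "V5 \<in> N" "\<forall>y\<in>V5. inv y \<in> V4" using nhds_inv[OF V4(1)] by blast
        define W where "W = V1 \<inter> V2 \<inter> V4 \<inter> V5"
        have W: "W \<in> N" unfolding W_def using V1(1) V2(1) V4(1) V5(1) by (simp add: nhds_Int)
        have "small V x y" if "x \<in> B <#> W" "y \<in> B <#> W" for x y
        proof -
          obtain b v c w where *: "b \<in> B" "v \<in> W" "x = b \<otimes> v" "c \<in> B" "w \<in> W" "y = c \<otimes> w"
            using \<open>x \<in> B <#> W\<close> \<open>y \<in> B <#> W\<close> unfolding set_mult_def by blast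
          have G: "b \<in> carrier G" "c \<in> carrier G" "v \<in> carrier G" "w \<in> carrier G"
            using * B(2) nhds_subset[OF W] by auto
          have "inv v \<otimes> (inv b \<otimes> c) \<otimes> w \<in> V"
            using V1(2) V2(2) B(3) * by (auto simp: W_def small_def)
          moreover have "(b \<otimes> inv d) \<otimes> (d \<otimes> (v \<otimes> inv w) \<otimes> inv d) \<otimes> (d \<otimes> inv c) \<in> V"
            using V1(2) V3(2) V4(2) V5(2) B(3) d * by (auto simp: W_def small_def)
          ultimately show ?thesis
            using G dG * by (simp add: small_def m_assoc inv_cancel inv_mult_group)
        qed
        moreover have "B <#> W \<in> p"
          using B W nhds_subset[OF W] by (intro pI[of _ B W] set_mult_closed) auto
        ultimately show ?thesis by blast
      qed
    qed
    have "p \<in> ?K" using in_closure_embed[OF AG p] pu u(1,2,3) by metis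
    then obtain U where U: "U \<in> \<U>" "p \<in> U" using \<U> by blast
    then obtain S where S: "S \<in> p" "basic_open S \<subseteq> U"
      using \<U> unfolding openin_completion_topology by blast
    then obtain B V where B: "B \<in> u" "V \<in> N" "B \<subseteq> carrier G" "B <#> V \<subseteq> S" "S \<subseteq> carrier G"
      unfolding p_def by blast
    then have "basic_open (B <#> V) \<subseteq> U" using S basic_open_mono by blast
    then have "B \<in> I" using B U(1) unfolding I_def by blast
    then show False using u(5) B(1) by blast
  qed
  then obtain K where K: "finite K" "K \<subseteq> I" "A \<subseteq> \<Union>K" by blast
  show "\<exists>\<F>. finite \<F> \<and> \<F> \<subseteq> \<U> \<and> ?K \<subseteq> \<Union>\<F>"
  proof -
    have "\<forall>B\<in>K. \<exists>V U. V \<in> N \<and> U \<in> \<U> \<and> basic_open (B <#> V) \<subseteq> U"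
      using K(2) unfolding I_def by blast
    then obtain V U where VU: "\<And>B. B \<in> K \<Longrightarrow> V B \<in> N \<and> U B \<in> \<U> \<and> basic_open (B <#> V B) \<subseteq> U B"
      by metis
    \<comment> \<open>The factor \<open>carrier G\<close> keeps this a neighbourhood when
      \<open>K\<close> is empty. A set of \<open>p\<close> that is small of this order and meets
      \<open>B\<close> lies in \<open>B <#> V B\<close>, which puts \<open>p\<close> into
      \<open>U B\<close>.\<close>
    have W: "carrier G \<inter> (\<Inter>B\<in>K. V B) \<in> N" using K(1) VU by (intro nhds_INT) auto
    have "\<exists>B\<in>K. p \<in> U B" if p: "p \<in> ?K" for p
    proof -
      have pp: "p \<in> points" using p in_closure_of topspace_completion by metis
      obtain C where C: "C \<in> p" "\<forall>a\<in>C. \<forall>b\<in>C. small (carrier G \<inter> (\<Inter>B\<in>K. V B)) a b"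
        using pointsD(6)[OF pp W] by blast
      obtain a where a: "a \<in> A" "a \<in> C" using in_closure_embed[OF AG pp] p C(1) by blast
      obtain B where B: "B \<in> K" "a \<in> B" using a K(3) by blast
      have BG: "B \<subseteq> carrier G" using B(1) K(2) by (auto simp: I_def)
      have "C \<subseteq> B <#> V B"
      proof
        fix c assume c: "c \<in> C"
        have "inv a \<otimes> c \<in> V B" using C(2) a c B(1) by (auto simp: small_def)
        moreover have "c = a \<otimes> (inv a \<otimes> c)"
          using points_carrier[OF pp C(1)] a c by (simp add: inv_cancel)
        ultimately show "c \<in> B <#> V B" using B(2) unfolding set_mult_def by blast
      qed
      then have "B <#> V B \<in> p"
        using pointsD(5)[OF pp C(1)] set_mult_closed[OF BG nhds_subset] VU[OF B(1)] by blast
      then show ?thesis using VU[OF B(1)] B(1) pp unfolding basic_open_def by blast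
    qed
    then show ?thesis using K(1) VU by (intro exI[of _ "U ` K"]) auto
  qed
qed

text \<open>A set of \<open>p\<close> that is small of order \<open>V\<close> lies in
  \<open>d V\<close> for any \<open>d\<close> in it. Hence the basic set of \<open>d V\<close> is a
  neighbourhood of \<open>p\<close>, contained in the compact closure of the image of
  \<open>d V\<close>.\<close>

lemma locally_compact_group_completion:
  assumes V: "V \<in> N" and pc: "precompact V"
  shows "locally_compact_group completion completion_topology"
proof (intro locally_compact_group.intro locally_compact_group_axioms.intro)
  show "topological_group completion completion_topology" by (rule topological_group_completion)
  show "Hausdorff_space completion_topology" by (rule Hausdorff_completion)
  show "locally_compact_space completion_topology"
    unfolding locally_compact_space_def topspace_completion
  proof
    fix p assume p: "p \<in> points"
    obtain C where C: "C \<in> p" "\<forall>a\<in>C. \<forall>b\<in>C. small V a b" using pointsD(6)[OF p V] by blast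
    obtain d where d: "d \<in> C" using points_inhabited[OF p C(1)] by blast
    have dG: "d \<in> carrier G" using points_carrier[OF p C(1) d] .
    have sub: "d <# V \<subseteq> carrier G" using nhds_subset[OF V] dG by (rule l_coset_subset_G)
    have "C \<subseteq> d <# V"
    proof
      fix c assume c: "c \<in> C"
      have "c = d \<otimes> (inv d \<otimes> c)" using points_carrier[OF p C(1) c] dG by (simp add: inv_cancel)
      moreover have "inv d \<otimes> c \<in> V" using C(2) c d by (simp add: small_def)
      ultimately show "c \<in> d <# V" unfolding l_coset_def by blast
    qed
    then have "d <# V \<in> p" using pointsD(5)[OF p C(1)] sub by blast
    then have "p \<in> basic_open (d <# V)" using p by (simp add: basic_open_def)
    moreover have "basic_open (d <# V) \<subseteq> completion_topology closure_of (embed ` (d <# V))"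
    proof
      fix q assume "q \<in> basic_open (d <# V)"
      then have q: "q \<in> points" "d <# V \<in> q" by (auto simp: basic_open_def)
      then have "(d <# V) \<inter> B \<noteq> {}" if "B \<in> q" for B
        using pointsD(3)[OF q(1)] pointsD(4)[OF q that] by metis
      then show "q \<in> completion_topology closure_of (embed ` (d <# V))"
        using in_closure_embed[OF sub q(1)] by blast
    qed
    moreover have "compactin completion_topology (completion_topology closure_of (embed ` (d <# V)))"
      using precompact_translate[OF pc dG] by (rule compactin_closure_embed)
    ultimately show "\<exists>U K. openin completion_topology U \<and> compactin completion_topology K \<and> p \<in> U \<and> U \<subseteq> K"
      using openin_basic_open by blast
  qed
qed

end

section \<open>From chains to good models\<close>

text \<open>For a generator or its inverse, the right translate lies in the square of \<Lambda>; for
  a product, the two finite sets multiply. This bounds \<Lambda> against conjugated neighbourhoods,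
  since \<open>g\<^sup>-\<^sup>1 (a\<^sup>-\<^sup>1 b) g\<close> is the left quotient of
  \<open>a g\<close> and \<open>b g\<close>.\<close>

lemma (in group) generate_translate_cover:
  assumes L: "approximate_subgroup G \<Lambda>" and "g \<in> generate G \<Lambda>"
  shows "\<exists>E. finite E \<and> E \<subseteq> carrier G \<and> \<Lambda> <#> {g} \<subseteq> E <#> \<Lambda>"
  using assms(2)
proof (induction g rule: generate.induct)
  note D = approximate_subgroupD[OF L]
  obtain F where F: "finite F" "F \<subseteq> carrier G" "\<Lambda> <#> \<Lambda> \<subseteq> F <#> \<Lambda>" using D(4) by blast
  {
    case one
    have "\<Lambda> <#> {\<one>} = {\<one>} <#> \<Lambda>" using D(1) by (simp add: set_mult_def subset_iff)
    then show ?case by (intro exI[of _ "{\<one>}"]) simp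
  next
    case (incl h)
    then have "\<Lambda> <#> {h} \<subseteq> F <#> \<Lambda>" using F(3) by (auto simp: set_mult_def)
    then show ?case using F by blast
  next
    case (inv h)
    then have "\<Lambda> <#> {inv h} \<subseteq> F <#> \<Lambda>"
      using F(3) D(3) mono_set_mult[of \<Lambda> \<Lambda> "{inv h}" \<Lambda>] by blast
    then show ?case using F by blast
  next
    case (eng h1 h2)
    have G: "h1 \<in> carrier G" "h2 \<in> carrier G"
      using eng.hyps generate_incl[OF D(1)] by auto
    obtain E1 where E1: "finite E1" "E1 \<subseteq> carrier G" "\<Lambda> <#> {h1} \<subseteq> E1 <#> \<Lambda>" using eng.IH(1) by blast
    obtain E2 where E2: "finite E2" "E2 \<subseteq> carrier G" "\<Lambda> <#> {h2} \<subseteq> E2 <#> \<Lambda>" using eng.IH(2) by blast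
    have "\<Lambda> <#> {h1 \<otimes> h2} = \<Lambda> <#> ({h1} <#> {h2})" by (simp add: set_mult_def)
    also have "\<dots> = (\<Lambda> <#> {h1}) <#> {h2}" using G D(1) by (simp add: set_mult_assoc)
    also have "\<dots> \<subseteq> (E1 <#> \<Lambda>) <#> {h2}" using E1(3) by (simp add: mono_set_mult)
    also have "\<dots> = E1 <#> (\<Lambda> <#> {h2})" using G D(1) E1(2) by (simp add: set_mult_assoc)
    also have "\<dots> \<subseteq> E1 <#> (E2 <#> \<Lambda>)" using E2(3) by (simp add: mono_set_mult)
    also have "\<dots> = (E1 <#> E2) <#> \<Lambda>" using D(1) E1(2) E2(2) by (simp add: set_mult_assoc)
    finally show ?case
      using E1 E2 by (intro exI[of _ "E1 <#> E2"]) (simp add: finite_set_mult set_mult_closed)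
  }
qed

section \<open>The completion attached to a chain\<close>

lemma chain_imp_good_model:
  fixes G :: "('a, 'b) monoid_scheme" (structure) and L :: "nat \<Rightarrow> 'a set"
  assumes "group G" and L: "\<And>n. approximate_subgroup G (L n)"
    and L_mult: "\<And>n. L (Suc n) <#> L (Suc n) \<subseteq> L n"
    and L_comm: "\<And>n. commensurable G (L n) (L 0)"
  shows "\<exists>(H :: 'a set set monoid) T f. good_model G (L 0) H T f"
proof -
  interpret group G by fact
  note D = approximate_subgroupD[OF L]
  define \<Gamma> where "\<Gamma> = generate G (L 0)"
  have sub: "subgroup \<Gamma> G" unfolding \<Gamma>_def using D(1) by (rule generate_is_subgroup)
  interpret \<Gamma>: subgroup \<Gamma> G by (rule sub)
  have L0\<Gamma>: "L 0 \<subseteq> \<Gamma>" unfolding \<Gamma>_def by (auto intro: generate.incl)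
  have mult: "x \<otimes> y \<in> L n" if "x \<in> L (Suc n)" "y \<in> L (Suc n)" for x y n
    using L_mult[of n] that unfolding set_mult_def by blast
  have "L (Suc n) \<subseteq> L n" for n
  proof
    fix x assume x: "x \<in> L (Suc n)"
    then have "x \<otimes> \<one> \<in> L n" using D(2) by (rule mult)
    then show "x \<in> L n" using x D(1) by (simp add: subset_iff)
  qed
  then have dec: "L n \<subseteq> L m" if "m \<le> n" for m n using that by (rule lift_Suc_antimono_le)
  define G' where "G' = G\<lparr>carrier := \<Gamma>\<rparr>"
  have G': "carrier G' = \<Gamma>" "\<And>x y. x \<otimes>\<^bsub>G'\<^esub> y = x \<otimes> y" "\<one>\<^bsub>G'\<^esub> = \<one>"
    by (simp_all add: G'_def)
  have inv': "inv\<^bsub>G'\<^esub> x = inv x" if "x \<in> \<Gamma>" for x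
    unfolding G'_def using sub that by (rule m_inv_consistent)
  \<comment> \<open>Intersecting finitely many conjugates makes the neighbourhoods of \<open>\<one>\<close> conjugation invariant.\<close>
  define K where "K n F = {x \<in> \<Gamma>. \<forall>g\<in>F. inv g \<otimes> x \<otimes> g \<in> L n}" for n F
  define N where "N = {V. V \<subseteq> \<Gamma> \<and> (\<exists>n F. finite F \<and> F \<subseteq> \<Gamma> \<and> K n F \<subseteq> V)}"
  have NI: "V \<in> N" if "V \<subseteq> \<Gamma>" "finite F" "F \<subseteq> \<Gamma>" "K n F \<subseteq> V" for V n F
    unfolding N_def using that by blast
  have NE: "\<exists>n F. V \<subseteq> \<Gamma> \<and> finite F \<and> F \<subseteq> \<Gamma> \<and> K n F \<subseteq> V" if "V \<in> N" for V
    using that unfolding N_def by blast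
  have KN: "K n F \<in> N" if "finite F" "F \<subseteq> \<Gamma>" for n F
    using that by (intro NI) (auto simp: K_def)
  have K_dec: "K n F \<subseteq> K m F'" if "m \<le> n" "F' \<subseteq> F" for m n F F'
    using dec[OF that(1)] that(2) unfolding K_def by blast
  interpret S: group_nhds G' N
  proof (intro group_nhds.intro group_nhds_axioms.intro)
    show "group G'" unfolding G'_def using sub by (rule subgroup_imp_group)
    show "V \<subseteq> carrier G'" if "V \<in> N" for V using NE[OF that] G'(1) by blast
    show "\<one>\<^bsub>G'\<^esub> \<in> V" if V: "V \<in> N" for V
    proof -
      obtain n F where F: "F \<subseteq> \<Gamma>" "K n F \<subseteq> V" using NE[OF V] by blast
      have "\<one> \<in> K n F" using F(1) D(2) \<Gamma>.mem_carrier by (auto simp: K_def)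
      then show ?thesis using F(2) G'(3) by auto
    qed
    show "carrier G' \<in> N" using G'(1) by (intro NI[of _ "{}" 0]) (auto simp: K_def)
    show "V \<inter> W \<in> N" if V: "V \<in> N" and W: "W \<in> N" for V W
    proof -
      obtain n F where F: "V \<subseteq> \<Gamma>" "finite F" "F \<subseteq> \<Gamma>" "K n F \<subseteq> V" using NE[OF V] by blast
      obtain m E where E: "finite E" "E \<subseteq> \<Gamma>" "K m E \<subseteq> W" using NE[OF W] by blast
      have "K (n + m) (F \<union> E) \<subseteq> V \<inter> W"
        using F(4) E(3) K_dec[of n "n + m" F "F \<union> E"] K_dec[of m "n + m" E "F \<union> E"] by auto
      then show ?thesis using F E by (intro NI[of _ "F \<union> E" "n + m"]) auto
    qed
    show "W \<in> N" if V: "V \<in> N" and W: "V \<subseteq> W" "W \<subseteq> carrier G'" for V W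
    proof -
      obtain n F where "finite F" "F \<subseteq> \<Gamma>" "K n F \<subseteq> V" using NE[OF V] by blast
      then show ?thesis using W G'(1) by (intro NI[of W F n]) auto
    qed
    show "\<exists>W\<in>N. \<forall>x\<in>W. \<forall>y\<in>W. inv\<^bsub>G'\<^esub> x \<otimes>\<^bsub>G'\<^esub> y \<in> V" if V: "V \<in> N" for V
    proof -
      obtain n F where F: "finite F" "F \<subseteq> \<Gamma>" "K n F \<subseteq> V" using NE[OF V] by blast
      have "inv x \<otimes> y \<in> K n F" if "x \<in> K (Suc n) F" "y \<in> K (Suc n) F" for x y
      proof -
        have xy: "x \<in> \<Gamma>" "y \<in> \<Gamma>" using that by (simp_all add: K_def)
        have "inv g \<otimes> (inv x \<otimes> y) \<otimes> g \<in> L n" if g: "g \<in> F" for g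
        proof -
          have gG: "g \<in> \<Gamma>" using g F(2) by blast
          have "inv g \<otimes> x \<otimes> g \<in> L (Suc n)" "inv g \<otimes> y \<otimes> g \<in> L (Suc n)"
            using g \<open>x \<in> K (Suc n) F\<close> \<open>y \<in> K (Suc n) F\<close> by (simp_all add: K_def)
          \<comment> \<open>Conjugation by \<open>g\<close> is a homomorphism, so one step down the
            chain controls the quotient for the same index set \<open>F\<close>.\<close>
          then have "inv (inv g \<otimes> x \<otimes> g) \<otimes> (inv g \<otimes> y \<otimes> g) \<in> L n" by (simp add: mult D(3))
          then show ?thesis using gG xy by (simp add: inv_mult_group m_assoc inv_cancel)
        qed
        then show ?thesis using xy by (simp add: K_def)
      qed
      then have "\<forall>x\<in>K (Suc n) F. \<forall>y\<in>K (Suc n) F. inv\<^bsub>G'\<^esub> x \<otimes>\<^bsub>G'\<^esub> y \<in> V"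
        using F(3) inv' G'(2) by (auto simp: K_def)
      then show ?thesis using KN[OF F(1,2)] by blast
    qed
    show "\<exists>W\<in>N. \<forall>y\<in>W. x \<otimes>\<^bsub>G'\<^esub> y \<otimes>\<^bsub>G'\<^esub> inv\<^bsub>G'\<^esub> x \<in> V" if V: "V \<in> N" and "x \<in> carrier G'" for V x
    proof -
      have x: "x \<in> \<Gamma>" using that G'(1) by simp
      obtain n F where F: "finite F" "F \<subseteq> \<Gamma>" "K n F \<subseteq> V" using NE[OF V] by blast
      \<comment> \<open>Conjugating \<open>x y x\<^sup>-\<^sup>1\<close> by \<open>g\<close> is
        conjugating \<open>y\<close> by \<open>x\<^sup>-\<^sup>1 g\<close>, so conjugation by
        \<open>x\<close> only translates the finite index set.\<close>
      let ?E = "(\<lambda>g. inv x \<otimes> g) ` F"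
      have "x \<otimes> y \<otimes> inv x \<in> K n F" if y: "y \<in> K n ?E" for y
      proof -
        have yG: "y \<in> \<Gamma>" using y by (simp add: K_def)
        have "inv g \<otimes> (x \<otimes> y \<otimes> inv x) \<otimes> g \<in> L n" if g: "g \<in> F" for g
        proof -
          have gG: "g \<in> \<Gamma>" using g F(2) by blast
          have "inv (inv x \<otimes> g) \<otimes> y \<otimes> (inv x \<otimes> g) \<in> L n" using y g by (simp add: K_def)
          then show ?thesis using gG x yG by (simp add: inv_mult_group m_assoc)
        qed
        then show ?thesis using x yG by (simp add: K_def)
      qed
      then have "\<forall>y\<in>K n ?E. x \<otimes>\<^bsub>G'\<^esub> y \<otimes>\<^bsub>G'\<^esub> inv\<^bsub>G'\<^esub> x \<in> V"
        using F(3) inv'[OF x] G'(2) by auto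
      moreover have "finite ?E" "?E \<subseteq> \<Gamma>" using F x by auto
      ultimately show ?thesis using KN by blast
    qed
  qed
  have L0N: "L 0 \<in> N"
    using L0\<Gamma> by (intro NI[of _ "{\<one>}" 0]) (auto simp: K_def)
  have cover: "finite_cover_by (\<lambda>a b. inv g \<otimes> (inv a \<otimes> b) \<otimes> g \<in> L n) (L 0)" if g: "g \<in> \<Gamma>" for g n
  proof -
    have "\<exists>E. finite E \<and> E \<subseteq> carrier G \<and> L 0 <#> {g} \<subseteq> E <#> L 0"
      using g unfolding \<Gamma>_def by (rule generate_translate_cover[OF L])
    then obtain E where E: "finite E" "E \<subseteq> carrier G" "L 0 <#> {g} \<subseteq> E <#> L 0" by blast
    \<comment> \<open>The index is \<open>Suc n\<close> because the left quotient of two elements of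
      one translate lies in the square of \<open>L (Suc n)\<close>, hence in
      \<open>L n\<close>.\<close>
    obtain F where F: "finite F" "F \<subseteq> carrier G" "L 0 \<subseteq> F <#> L (Suc n)"
      using L_comm[of "Suc n"] unfolding commensurable_def by blast
    have "L 0 <#> {g} \<subseteq> E <#> (F <#> L (Suc n))"
      using E(3) mono_set_mult[OF order_refl F(3), of G E] by blast
    also have "\<dots> = (E <#> F) <#> L (Suc n)" using E(2) F(2) D(1) by (simp add: set_mult_assoc)
    finally have sub': "L 0 <#> {g} \<subseteq> (E <#> F) <#> L (Suc n)" .
    let ?\<C> = "(\<lambda>e. e <# L (Suc n)) ` (E <#> F)"
    have EF: "finite (E <#> F)" "E <#> F \<subseteq> carrier G"
      using E(1,2) F(1,2) by (simp_all add: finite_set_mult set_mult_closed)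
    have "inv x \<otimes> y \<in> L n" if "e \<in> E <#> F" "x \<in> e <# L (Suc n)" "y \<in> e <# L (Suc n)" for e x y
    proof -
      obtain u v where uv: "u \<in> L (Suc n)" "v \<in> L (Suc n)" "x = e \<otimes> u" "y = e \<otimes> v"
        using \<open>x \<in> e <# L (Suc n)\<close> \<open>y \<in> e <# L (Suc n)\<close> unfolding l_coset_def by blast
      have "e \<in> carrier G" "u \<in> carrier G" "v \<in> carrier G"
        using EF(2) \<open>e \<in> E <#> F\<close> uv D(1) by auto
      then have "inv x \<otimes> y = inv u \<otimes> v" using uv by (simp add: inv_mult_group m_assoc inv_cancel)
      then show ?thesis using uv(1,2) by (simp add: mult D(3))
    qed
    then have "\<forall>C\<in>?\<C>. \<forall>x\<in>C. \<forall>y\<in>C. inv x \<otimes> y \<in> L n" by blast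
    moreover have "L 0 <#> {g} \<subseteq> \<Union>?\<C>" using sub' by (auto simp: set_mult_def l_coset_def)
    ultimately have "finite_cover_by (\<lambda>x y. inv x \<otimes> y \<in> L n) (L 0 <#> {g})"
      unfolding finite_cover_by_def using EF(1) by (intro exI[of _ ?\<C>]) simp
    then show ?thesis
    proof (rule finite_cover_by_vimage)
      show "(\<lambda>a. a \<otimes> g) ` L 0 \<subseteq> L 0 <#> {g}" by (auto simp: set_mult_def)
      fix a b assume "a \<in> L 0" "b \<in> L 0" "inv (a \<otimes> g) \<otimes> (b \<otimes> g) \<in> L n"
      moreover from this have "a \<in> carrier G" "b \<in> carrier G" using D(1) by auto
      ultimately show "inv g \<otimes> (inv a \<otimes> b) \<otimes> g \<in> L n"
        using g by (simp add: inv_mult_group m_assoc)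
    qed
  qed
  have pc: "S.precompact (L 0)"
    unfolding S.precompact_def
  proof (intro conjI ballI)
    show "L 0 \<subseteq> carrier G'" using L0\<Gamma> G'(1) by simp
    fix V assume V: "V \<in> N"
    obtain n F where F: "finite F" "F \<subseteq> \<Gamma>" "K n F \<subseteq> V" using NE[OF V] by blast
    have left: "finite_cover_by (\<lambda>a b. \<forall>g\<in>F. inv g \<otimes> (inv a \<otimes> b) \<otimes> g \<in> L n) (L 0)"
      using F by (intro finite_cover_by_ball cover) auto
    \<comment> \<open>\<open>L 0\<close> is symmetric, so pulling back along inversion turns left
      quotients into right ones.\<close>
    then have "finite_cover_by (\<lambda>a b. \<forall>g\<in>F. inv g \<otimes> (a \<otimes> inv b) \<otimes> g \<in> L n) (L 0)"
      by (rule finite_cover_by_vimage[where h = "m_inv G"]) (use D(1,3) in \<open>auto simp: subset_iff\<close>)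
    from finite_cover_by_conj[OF left this] show "finite_cover_by (S.small V) (L 0)"
    proof (rule finite_cover_by_vimage[where h = "\<lambda>x. x"])
      fix a b assume "a \<in> L 0" "b \<in> L 0"
        and *: "(\<forall>g\<in>F. inv g \<otimes> (inv a \<otimes> b) \<otimes> g \<in> L n) \<and> (\<forall>g\<in>F. inv g \<otimes> (a \<otimes> inv b) \<otimes> g \<in> L n)"
      then have ab: "a \<in> \<Gamma>" "b \<in> \<Gamma>" using L0\<Gamma> by auto
      then have "inv a \<otimes> b \<in> K n F" "a \<otimes> inv b \<in> K n F" using * by (simp_all add: K_def)
      then show "S.small V a b" using F(3) ab inv' G'(2) by (auto simp: S.small_def)
    qed simp
  qed
  have "good_model G (L 0) S.completion S.completion_topology S.embed"
    unfolding good_model_def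
  proof (intro conjI exI)
    show "locally_compact_group S.completion S.completion_topology"
      using L0N pc by (rule S.locally_compact_group_completion)
    show "S.embed \<in> hom (G\<lparr>carrier := generate G (L 0)\<rparr>) S.completion"
      using S.embed_hom by (simp add: G'_def \<Gamma>_def)
    show "compactin S.completion_topology (S.completion_topology closure_of (S.embed ` L 0))"
      using pc by (rule S.compactin_closure_embed)
    \<comment> \<open>The basic set of \<open>L 0\<close> serves both as the neighbourhood and as
      the open set inside it. If it contains the image of \<open>x\<close>, then \<open>L 0\<close>
      contains a translate \<open>x V\<close> with \<open>V \<in> N\<close>, hence \<open>x\<close>
      itself.\<close>
    show "S.basic_open (L 0) \<subseteq> carrier S.completion"
      by (auto simp: S.basic_open_def S.completion_def)
    show "openin S.completion_topology (S.basic_open (L 0))" by (rule S.openin_basic_open)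
    show "\<one>\<^bsub>S.completion\<^esub> \<in> S.basic_open (L 0)"
      using S.nhds_in_points L0N by (simp add: S.completion_def S.basic_open_def)
    show "S.basic_open (L 0) \<subseteq> S.basic_open (L 0)" by simp
    show "{x \<in> generate G (L 0). S.embed x \<in> S.basic_open (L 0)} \<subseteq> L 0"
    proof
      fix x assume "x \<in> {x \<in> generate G (L 0). S.embed x \<in> S.basic_open (L 0)}"
      then have x: "x \<in> \<Gamma>" "L 0 \<in> S.embed x" by (auto simp: S.basic_open_def \<Gamma>_def)
      obtain V where "V \<in> N" "x <#\<^bsub>G'\<^esub> V \<subseteq> L 0" using x(2) by (rule S.embedE)
      then have "x \<otimes> \<one> \<in> L 0" using S.one_mem_nhds G'(2,3) unfolding l_coset_def by fastforce
      then show "x \<in> L 0" using x(1) by simp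
    qed
  qed
  then show ?thesis by blast
qed

theorem proposition1p2:
  fixes G :: "('a, 'b) monoid_scheme" and \<Lambda> :: "'a set"
  assumes "group G" and "approximate_subgroup G \<Lambda>"
  shows "((\<exists>(H :: 'a set set monoid) T f. good_model G \<Lambda> H T f) \<longleftrightarrow>
           (\<exists>L :: nat \<Rightarrow> 'a set.
              (\<forall>n. approximate_subgroup G (L n)) \<and> L 0 = \<Lambda> \<and>
              (\<forall>n. L (Suc n) <#>\<^bsub>G\<^esub> L (Suc n) \<subseteq> L n \<and> commensurable G (L n) \<Lambda>))) \<and>
         ((\<exists>(H :: ('h, 'm) monoid_scheme) T f. good_model G \<Lambda> H T f) \<longrightarrow>
           (\<exists>L :: nat \<Rightarrow> 'a set.
              (\<forall>n. approximate_subgroup G (L n)) \<and> L 0 = \<Lambda> \<and>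
              (\<forall>n. L (Suc n) <#>\<^bsub>G\<^esub> L (Suc n) \<subseteq> L n \<and> commensurable G (L n) \<Lambda>)))"
proof (intro conjI iffI impI)
  let ?chain = "\<exists>L :: nat \<Rightarrow> 'a set.
    (\<forall>n. approximate_subgroup G (L n)) \<and> L 0 = \<Lambda> \<and>
    (\<forall>n. L (Suc n) <#>\<^bsub>G\<^esub> L (Suc n) \<subseteq> L n \<and> commensurable G (L n) \<Lambda>)"
  show ?chain if "\<exists>(H :: 'a set set monoid) T f. good_model G \<Lambda> H T f"
    using that by (elim exE) (rule good_model_imp_chain[OF assms])
  show ?chain if "\<exists>(H :: ('h, 'm) monoid_scheme) T f. good_model G \<Lambda> H T f"
    using that by (elim exE) (rule good_model_imp_chain[OF assms])
  assume ?chain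
  then obtain L where L: "\<forall>n. approximate_subgroup G (L n)" "L 0 = \<Lambda>"
    "\<forall>n. L (Suc n) <#>\<^bsub>G\<^esub> L (Suc n) \<subseteq> L n \<and> commensurable G (L n) \<Lambda>"
    by (elim exE conjE) (rule that)
  then show "\<exists>(H :: 'a set set monoid) T f. good_model G \<Lambda> H T f"
    using chain_imp_good_model[OF assms(1), of L] by simp
qed

end
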